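(* Let $n\in\mathbb{N}$, $0<r_j<\infty$, $1\le p_j<\infty$ and $1\le\theta_j\le\infty$ for $j=1,\ldots,n$. Let $$r=n\Big(\sum_{j=1}^n\frac1{r_j}\Big)^{-1},\qquad p=\frac nr\Big(\sum_{j=1}^n\frac1{p_jr_j}\Big)^{-1},\qquad \beta_j=\frac1{r_j}\Big(\frac rn+\frac1{p_j}-\frac1p\Big),$$ and suppose that $\beta_j>0$ for all $j=1,\ldots,n$. Let $p_0>0$ be such that $$\frac1{p_0}>\frac1p-\frac rn,$$ and let $\max(1,p_0)<q<\infty$ be such that $$\frac1q>\frac1p-\frac rn.$$ Then for every $s>0$ there is a constant $c$, independent of $f$, such that every locally integrable function $f\in S_0(\mathbb{R}^n)$ with $f\in b_{p_1,\ldots,p_n;\theta_1,\ldots,\theta_n}^{r_1,\ldots,r_n}(\mathbb{R}^n)$ and $f\in L^1(\mathbb{R}^n)+L^{p_0}(\mathbb{R}^n)$ belongs to $L^{q,s}(\mathbb{R}^n)$ and satisfies $$\|f\|_{q,s}\le c\Big[\|f\|_{L^1+L^{p_0}}+\prod_{j=1}^n\|f\|_{b_{p_j,\theta_j;j}^{r_j}}^{\frac{r}{nr_j}}\Big].$$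
   Context: $\mathbb{R}_+=(0,\infty)$. $S_0(\mathbb{R}^n)$ is the class of measurable, almost everywhere finite functions $f$ on $\mathbb{R}^n$ such that $|\{x:|f(x)|>y\}|<\infty$ for every $y>0$. For $f\in S_0(\mathbb{R}^n)$, $f^*$ is the non-increasing rearrangement, $f^*(t)=\sup_{|E|=t}\inf_{x\in E}|f(x)|$, $0<t<\infty$. For $0<q,s<\infty$, $L^{q,s}(\mathbb{R}^n)$ is the Lorentz space of $f\in S_0(\mathbb{R}^n)$ with $\|f\|_{q,s}=\big(\int_0^\infty (t^{1/q}f^*(t))^s\,\frac{dt}{t}\big)^{1/s}<\infty$. $\|f\|_{L^1+L^{p_0}}=\inf\{\|g\|_1+\|h\|_{p_0}: f=g+h,\ g\in L^1(\mathbb{R}^n),\ h\in L^{p_0}(\mathbb{R}^n)\}$. For $k\in\mathbb{N}$, $h\in\mathbb{R}$, $\Delta_j^k(h)f(x)=\sum_{i=0}^k(-1)^{k-i}\binom ki f(x+ihe_j)$, where $e_j$ is the $j$-th unit coordinate vector. For $r>0$, $1\le p<\infty$, $1\le\theta\le\infty$, $$\|f\|_{b_{p,\theta;j}^r}=\Big(\int_0^\infty[h^{-r}\|\Delta_j^k(h)f\|_p]^\theta\frac{dh}{h}\Big)^{1/\theta}$$ (essential supremum over $h>0$ of $h^{-r}\|\Delta_j^k(h)f\|_p$ if $\theta=\infty$), where $k>r$ is a fixed integer; different choices of $k>r$ give equivalent seminorms. The space $b_{p_1,\ldots,p_n;\theta_1,\ldots,\theta_n}^{r_1,\ldots,r_n}(\mathbb{R}^n)$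 consists of all $f\in S_0(\mathbb{R}^n)$ with $\sum_{j=1}^n\|f\|_{b_{p_j,\theta_j;j}^{r_j}}<\infty$. *)

theory Defs
  imports "HOL-Analysis.Analysis" "HOL-Probability.Essential_Supremum"
begin

text \<open>
  Functions are real-valued (an almost everywhere finite function being identified with a
  real-valued representative) and measurable in the sense of Lebesgue. All norms take values
  in \<^typ>\<open>ennreal\<close>, so that membership in a space is finiteness of its norm.
\<close>

text \<open>Real powers of extended non-negative numbers; only meant for positive exponents.\<close>

definition epowr :: "ennreal \<Rightarrow> real \<Rightarrow> ennreal"  (infixr "powr\<^sub>e" 80) where
  "x powr\<^sub>e a = (if x = \<infinity> then \<infinity> else ennreal (enn2real x powr a))"

definition S0 :: "(real ^ 'n::finite \<Rightarrow> real) set" where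
  "S0 = {f \<in> borel_measurable lebesgue. \<forall>y>0. emeasure lebesgue {x. \<bar>f x\<bar> > y} < \<infinity>}"

definition rearrangement :: "(real ^ 'n::finite \<Rightarrow> real) \<Rightarrow> real \<Rightarrow> ennreal" where
  "rearrangement f t =
     (SUP E \<in> {E \<in> sets lebesgue. emeasure lebesgue E = ennreal t}. INF x\<in>E. ennreal \<bar>f x\<bar>)"

definition lorentz_norm :: "real \<Rightarrow> real \<Rightarrow> (real ^ 'n::finite \<Rightarrow> real) \<Rightarrow> ennreal" where
  "lorentz_norm q s f =
     (\<integral>\<^sup>+ t\<in>{0<..}. (ennreal (t powr (1 / q)) * rearrangement f t) powr\<^sub>e s * ennreal (1 / t) \<partial>lborel)
       powr\<^sub>e (1 / s)"

definition lorentz_space :: "real \<Rightarrow> real \<Rightarrow> (real ^ 'n::finite \<Rightarrow> real) set" where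
  "lorentz_space q s = {f \<in> S0. lorentz_norm q s f < \<infinity>}"

definition Lp_norm :: "real \<Rightarrow> (real ^ 'n::finite \<Rightarrow> real) \<Rightarrow> ennreal" where
  "Lp_norm p f = (\<integral>\<^sup>+ x. ennreal (\<bar>f x\<bar> powr p) \<partial>lebesgue) powr\<^sub>e (1 / p)"

definition Lp_space :: "real \<Rightarrow> (real ^ 'n::finite \<Rightarrow> real) set" where
  "Lp_space p = {f \<in> borel_measurable lebesgue. Lp_norm p f < \<infinity>}"

definition L1_plus_Lp :: "real \<Rightarrow> (real ^ 'n::finite \<Rightarrow> real) set" where
  "L1_plus_Lp p = {f \<in> borel_measurable lebesgue.
     \<exists>g\<in>Lp_space 1. \<exists>h\<in>Lp_space p. AE x in lebesgue. f x = g x + h x}"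

definition L1_plus_Lp_norm :: "real \<Rightarrow> (real ^ 'n::finite \<Rightarrow> real) \<Rightarrow> ennreal" where
  "L1_plus_Lp_norm p f =
     Inf {Lp_norm 1 g + Lp_norm p h | g h.
            g \<in> Lp_space 1 \<and> h \<in> Lp_space p \<and> (AE x in lebesgue. f x = g x + h x)}"

definition locally_integrable :: "(real ^ 'n::finite \<Rightarrow> real) \<Rightarrow> bool" where
  "locally_integrable f \<longleftrightarrow> (\<forall>K. compact K \<longrightarrow> f absolutely_integrable_on K)"

definition difference ::
  "nat \<Rightarrow> 'n::finite \<Rightarrow> real \<Rightarrow> (real ^ 'n \<Rightarrow> real) \<Rightarrow> real ^ 'n \<Rightarrow> real" where
  "difference k j h f x =
     (\<Sum>i\<le>k. (-1) ^ (k - i) * real (k choose i) * f (x + (real i * h) *\<^sub>R axis j 1))"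

text \<open>
  The parameter \<open>k\<close> is the order of the difference, to be taken larger than \<open>r\<close>.
\<close>

definition besov_seminorm ::
  "nat \<Rightarrow> real \<Rightarrow> real \<Rightarrow> ennreal \<Rightarrow> 'n::finite \<Rightarrow> (real ^ 'n \<Rightarrow> real) \<Rightarrow> ennreal" where
  "besov_seminorm k r p \<theta> j f =
     (if \<theta> = \<infinity>
      then esssup (restrict_space lborel {0<..})
             (\<lambda>h. ennreal (h powr (- r)) * Lp_norm p (difference k j h f))
      else (\<integral>\<^sup>+ h\<in>{0<..}.
              (ennreal (h powr (- r)) * Lp_norm p (difference k j h f)) powr\<^sub>e enn2real \<theta>
                * ennreal (1 / h) \<partial>lborel)
             powr\<^sub>e (1 / enn2real \<theta>))"

definition besov_space ::
  "('n \<Rightarrow> nat) \<Rightarrow> ('n \<Rightarrow> real) \<Rightarrow> ('n \<Rightarrow> real) \<Rightarrow> ('n \<Rightarrow> ennreal) \<Rightarrow> (real ^ 'n::finite \<Rightarrow> real) set" where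
  "besov_space k r p \<theta> =
     {f \<in> S0. (\<Sum>j\<in>UNIV. besov_seminorm (k j) (r j) (p j) (\<theta> j) j f) < \<infinity>}"

end

theory Submission
  imports Defs
begin

text \<open>
  Let \<open>d(\<mu>)\<close> be the measure of \<open>{\<bar>f\<bar> > \<mu>}\<close> and \<open>D\<close> the product of the Besov seminorms \<open>B\<^sub>j\<close> in the
  claim. Expanding a difference in each coordinate bounds \<open>\<bar>f(x)\<bar>\<close> by values of \<open>\<bar>f\<bar>\<close> at points
  \<open>x + (i\<^sub>1 y\<^sub>1, \<dots>, i\<^sub>n y\<^sub>n)\<close> with all \<open>i\<^sub>j \<ge> 1\<close>, plus differences. Average this over \<open>x\<close> in a level set
  of measure \<open>> t\<close> and over \<open>y\<close> in a box with sides \<open>h\<^sub>j\<close> whose volume is a large multiple of \<open>\<xi> t\<close>: if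
  \<open>d(\<mu>) \<le> \<xi> t\<close>, then for most \<open>y\<close> all these values are at most \<open>\<mu>\<close>. The choice
  \<open>h\<^sub>j \<sim> t powr \<beta>\<^sub>j * (D / B\<^sub>j) powr (1 / r\<^sub>j)\<close>, for which the product of the \<open>h\<^sub>j\<close> is proportional to \<open>t\<close>
  because the \<open>\<beta>\<^sub>j\<close> add up to 1, balances the differences and yields
  \<open>d(M \<mu> + C D t powr (r/n - 1/p)) \<le> t\<close> with \<open>M\<close> independent of \<open>\<xi>\<close>. As \<open>1/q > 1/p - r/n\<close>, the factor \<open>M\<close>
  is harmless in the iteration of this inequality once \<open>\<xi>\<close> is large, which controls the rearrangement
  for \<open>t \<le> 1\<close>; for \<open>t \<ge> 1\<close> the norm of \<open>L\<^sup>1 + L\<^sup>p\<^sup>0\<close> does.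
\<close>

section \<open>Pointwise bounds by differences in each coordinate\<close>

text \<open>The multiplicity \<open>i j\<close> counts the steps \<open>y $ j\<close> taken in
  direction \<open>j\<close>; the value 0 marks a direction not yet expanded.\<close>

definition dilate :: "('n \<Rightarrow> nat) \<Rightarrow> real ^ 'n::finite \<Rightarrow> real ^ 'n" where
  "dilate i y = (\<chi> j. real (i j) * y $ j)"

lemma dilate_fun_upd:
  "i j = 0 \<Longrightarrow> dilate (i(j := l)) y = dilate i y + (real l * y $ j) *\<^sub>R axis j 1"
  by (auto simp: dilate_def vec_eq_iff axis_def)

lemma dilate_zero [simp]: "dilate (\<lambda>_. 0) y = 0"
  by (simp add: dilate_def vec_eq_iff)

text \<open>The term of index 0 in the difference is \<open>f x\<close> up to sign, and the binomial
  coefficients of the remaining terms sum to at most \<open>2 ^ k\<close>.\<close>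

lemma abs_le_difference:
  fixes f :: "real ^ 'n::finite \<Rightarrow> real"
  assumes "\<And>l. 1 \<le> l \<Longrightarrow> l \<le> k \<Longrightarrow> \<bar>f (x + (real l * h) *\<^sub>R axis j 1)\<bar> \<le> \<mu>" and "0 \<le> \<mu>"
  shows "\<bar>f x\<bar> \<le> \<bar>difference k j h f x\<bar> + 2 ^ k * \<mu>"
proof -
  define u where "u l = (-1) ^ (k - l) * real (k choose l) * f (x + (real l * h) *\<^sub>R axis j 1)" for l
  have split: "{..k} = insert 0 {1..k}" by auto
  have "difference k j h f x = u 0 + (\<Sum>l=1..k. u l)"
    unfolding difference_def u_def[symmetric] split by simp
  moreover have "\<bar>u 0\<bar> = \<bar>f x\<bar>" by (simp add: u_def abs_mult)
  moreover have "\<bar>\<Sum>l=1..k. u l\<bar> \<le> 2 ^ k * \<mu>"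
  proof -
    have "\<bar>\<Sum>l=1..k. u l\<bar> \<le> (\<Sum>l=1..k. real (k choose l) * \<mu>)"
      by (rule order_trans[OF sum_abs], rule sum_mono)
         (auto simp: u_def abs_mult intro!: mult_left_mono assms)
    also have "\<dots> \<le> (\<Sum>l\<le>k. real (k choose l) * \<mu>)"
      using assms(2) by (intro sum_mono2) auto
    also have "\<dots> = 2 ^ k * \<mu>"
      by (simp add: sum_distrib_right[symmetric] of_nat_sum[symmetric] choose_row_sum del: of_nat_sum)
    finally show ?thesis .
  qed
  ultimately show ?thesis by linarith
qed

text \<open>Induction on the set of expanded directions. A point not yet moved in direction
  \<open>j\<close> is compared by \<open>abs_le_difference\<close> with points moved there at least
  once. Once all directions are expanded, every multiplicity is positive, which is what the measure
  bound for dilations requires.\<close>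

lemma abs_le_differences:
  fixes f :: "real ^ 'n::finite \<Rightarrow> real"
  assumes "finite J" "0 \<le> \<mu>" "0 \<le> \<delta>"
    and "\<And>i. (\<And>j. j \<in> J \<Longrightarrow> 1 \<le> i j \<and> i j \<le> k j) \<Longrightarrow> (\<And>j. j \<notin> J \<Longrightarrow> i j = 0) \<Longrightarrow>
           \<bar>f (x + dilate i y)\<bar> \<le> \<mu>"
    and "\<And>i j. (\<And>l. i l \<le> k l) \<Longrightarrow> \<bar>difference (k j) j (y $ j) f (x + dilate i y)\<bar> \<le> \<delta>"
  shows "\<bar>f x\<bar> \<le> (\<Prod>j\<in>J. 2 ^ k j) * (\<mu> + real (card J) * \<delta>)"
  using assms(1,2,4)
proof (induction J arbitrary: \<mu> rule: finite_induct)
  case empty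
  then show ?case using empty(2)[of "\<lambda>_. 0"] by simp
next
  case (insert j J)
  have "\<bar>f (x + dilate i y)\<bar> \<le> 2 ^ k j * \<mu> + \<delta>"
    if i: "\<And>l. l \<in> J \<Longrightarrow> 1 \<le> i l \<and> i l \<le> k l" "\<And>l. l \<notin> J \<Longrightarrow> i l = 0" for i
  proof -
    have "\<bar>f (x + dilate i y)\<bar> \<le> \<bar>difference (k j) j (y $ j) f (x + dilate i y)\<bar> + 2 ^ k j * \<mu>"
    proof (rule abs_le_difference[OF _ insert.prems(1)])
      fix l assume l: "1 \<le> l" "l \<le> k j"
      have "\<bar>f (x + dilate (i(j := l)) y)\<bar> \<le> \<mu>"
        by (rule insert.prems(2)) (use i l insert.hyps in auto)
      then show "\<bar>f (x + dilate i y + (real l * y $ j) *\<^sub>R axis j 1)\<bar> \<le> \<mu>"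
        using i insert.hyps by (simp add: dilate_fun_upd add.assoc)
    qed
    moreover have "i l \<le> k l" for l using i[of l] by (cases "l \<in> J") auto
    then have "\<bar>difference (k j) j (y $ j) f (x + dilate i y)\<bar> \<le> \<delta>" by (rule assms(5))
    ultimately show ?thesis by linarith
  qed
  \<comment> \<open>The induction hypothesis is used with \<open>2 ^ k j * \<mu> + \<delta>\<close>
    in place of \<open>\<mu>\<close>; the factor \<open>2 ^ k j\<close> is then spread over all the
    terms with \<open>\<delta>\<close> as well.\<close>
  then have "\<bar>f x\<bar> \<le> (\<Prod>j\<in>J. 2 ^ k j) * (2 ^ k j * \<mu> + \<delta> + real (card J) * \<delta>)"
    using insert.prems(1) assms(3) by (intro insert.IH) auto
  also have "\<dots> \<le> (\<Prod>j\<in>J. 2 ^ k j) * (2 ^ k j * (\<mu> + real (Suc (card J)) * \<delta>))"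
  proof (intro mult_left_mono)
    have "(1 + real (card J)) * \<delta> * 1 \<le> (1 + real (card J)) * \<delta> * 2 ^ k j"
      using assms(3) by (intro mult_left_mono) auto
    then show "2 ^ k j * \<mu> + \<delta> + real (card J) * \<delta> \<le> 2 ^ k j * (\<mu> + real (Suc (card J)) * \<delta>)"
      by (simp add: algebra_simps)
  qed (auto intro: prod_nonneg)
  finally show ?case using insert.hyps by (simp add: mult_ac)
qed

section \<open>Measurability, translations, dilations and product integrals\<close>

lemma borel_measurable_dilate [measurable]: "dilate i \<in> borel_measurable borel"
  unfolding dilate_def by (intro borel_measurable_continuous_onI continuous_intros)

lemma borel_measurable_vec_nth_comp [measurable (raw)]:
  fixes g :: "'a \<Rightarrow> real ^ 'n::finite"
  assumes "g \<in> borel_measurable M"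
  shows "(\<lambda>x. g x $ j) \<in> borel_measurable M"
  by (rule measurable_compose[OF assms borel_measurable_continuous_onI]) (intro continuous_intros)

lemma borel_measurable_difference [measurable]:
  fixes f :: "real ^ 'n::finite \<Rightarrow> real"
  assumes [measurable]: "f \<in> borel_measurable borel" "g \<in> borel_measurable M" "h \<in> borel_measurable M"
  shows "(\<lambda>z. difference k j (h z) f (g z)) \<in> borel_measurable M"
  unfolding difference_def by measurable

lemma nn_integral_translate:
  fixes g :: "'a::euclidean_space \<Rightarrow> ennreal"
  assumes [measurable]: "g \<in> borel_measurable borel"
  shows "(\<integral>\<^sup>+ x. g (x + c) \<partial>lborel) = (\<integral>\<^sup>+ x. g x \<partial>lborel)"
proof -
  have "(\<integral>\<^sup>+ x. g x \<partial>lborel) = (\<integral>\<^sup>+ x. g x \<partial>(distr lborel borel ((+) c)))"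
    by (simp add: lborel_distr_plus)
  then show ?thesis by (simp add: nn_integral_distr add.commute)
qed

text \<open>The affine map in \<open>y\<close> multiplies volumes by the product of the
  \<open>i j\<close>, which is at least 1, so taking preimages does not increase the
  measure.\<close>

lemma emeasure_dilate_le:
  fixes F :: "(real ^ 'n::finite) set"
  assumes [measurable]: "F \<in> sets borel" and i: "\<And>j. 1 \<le> i j"
  shows "emeasure lborel {y. x + dilate i y \<in> F} \<le> emeasure lborel F"
proof -
  \<comment> \<open>The change of variables formula indexes the scaling factors by basis vectors, so
    the coordinate is recovered from its axis vector.\<close>
  define c where "c b = real (i (THE j. b = axis j 1))" for b :: "real ^ 'n"
  have nz: "i j \<noteq> 0" for j using i[of j] by simp
  have c_axis: "c (axis j 1) = real (i j)" for j by (simp add: c_def axis_eq_axis)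
  have Basis: "Basis = (\<lambda>j. axis j (1::real)) ` (UNIV :: 'n set)"
    by (auto simp: Basis_vec_def)
  have inj: "inj (\<lambda>j::'n. axis j (1::real))" by (auto simp: inj_on_def axis_eq_axis)
  have T: "x + (\<Sum>b\<in>Basis. (c b * (y \<bullet> b)) *\<^sub>R b) = x + dilate i y" for y
  proof -
    have "(\<Sum>b\<in>Basis. (c b * (y \<bullet> b)) *\<^sub>R b) = (\<Sum>j\<in>UNIV. (real (i j) * y $ j) *\<^sub>R axis j 1)"
      unfolding Basis by (subst sum.reindex[OF inj]) (simp add: c_axis inner_axis)
    also have "\<dots> = dilate i y"
      by (simp add: dilate_def vec_eq_iff axis_def if_distrib cong: if_cong)
    finally show ?thesis by simp
  qed
  have "lborel = density (distr lborel borel (\<lambda>y. x + (\<Sum>b\<in>Basis. (c b * (y \<bullet> b)) *\<^sub>R b)))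
      (\<lambda>_. ennreal (\<Prod>b\<in>Basis. \<bar>c b\<bar>))"
    by (rule lborel_affine_euclidean) (auto simp: Basis c_axis nz)
  then have eq: "lborel = density (distr lborel borel (\<lambda>y. x + dilate i y)) (\<lambda>_. ennreal (\<Prod>b\<in>Basis. \<bar>c b\<bar>))"
    unfolding T .
  have "emeasure lborel F = ennreal (\<Prod>b\<in>Basis. \<bar>c b\<bar>) * emeasure lborel {y. x + dilate i y \<in> F}"
    by (subst eq) (simp add: emeasure_density nn_integral_cmult emeasure_distr vimage_def)
  moreover have "1 \<le> (\<Prod>b\<in>Basis. \<bar>c b\<bar>)"
    using i by (intro prod_ge_1) (auto simp: Basis c_axis)
  ultimately show ?thesis
    using mult_right_mono[of 1 "ennreal (\<Prod>b\<in>Basis. \<bar>c b\<bar>)" "emeasure lborel {y. x + dilate i y \<in> F}"]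
    by simp
qed

lemma prod_Basis_vec:
  fixes g :: "real ^ 'n::finite \<Rightarrow> 'b::comm_monoid_mult"
  shows "(\<Prod>b\<in>Basis. g b) = (\<Prod>j\<in>UNIV. g (axis j 1))"
proof -
  have Basis: "(Basis :: (real ^ 'n) set) = (\<lambda>j. axis j (1::real)) ` (UNIV :: 'n set)"
    by (auto simp: Basis_vec_def)
  have inj: "inj (\<lambda>j::'n. axis j (1::real))" by (auto simp: inj_on_def axis_eq_axis)
  show ?thesis unfolding Basis by (subst prod.reindex[OF inj]) simp
qed

lemma nn_integral_vec_prod:
  fixes g :: "'n::finite \<Rightarrow> real \<Rightarrow> ennreal"
  assumes [measurable]: "\<And>j. g j \<in> borel_measurable borel"
  shows "(\<integral>\<^sup>+ y. (\<Prod>j\<in>UNIV. g j (y $ j)) \<partial>(lborel :: (real ^ 'n) measure)) = (\<Prod>j\<in>UNIV. \<integral>\<^sup>+ v. g j v \<partial>lborel)"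
proof -
  have "(\<Prod>j\<in>UNIV. g j (y $ j)) = (\<Prod>b\<in>Basis. g (axis_index b) (y \<bullet> b))" for y :: "real ^ 'n"
    by (simp add: prod_Basis_vec inner_axis)
  then have "(\<integral>\<^sup>+ y. (\<Prod>j\<in>UNIV. g j (y $ j)) \<partial>(lborel :: (real ^ 'n) measure)) =
      (\<integral>\<^sup>+ y. (\<Prod>b\<in>Basis. g (axis_index b) (y \<bullet> b)) \<partial>(lborel :: (real ^ 'n) measure))"
    by simp
  also have "\<dots> = (\<Prod>b\<in>(Basis :: (real ^ 'n) set). \<integral>\<^sup>+ v. g (axis_index b) v \<partial>lborel)"
    by (rule nn_integral_lborel_prod) auto
  finally show ?thesis by (simp add: prod_Basis_vec)
qed

section \<open>Powers of extended numbers, Lebesgue norms and a weak form of Hoelder's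
  inequality\<close>

lemma epowr_le_iff:
  assumes "0 < a" "0 \<le> c"
  shows "x powr\<^sub>e a \<le> ennreal c \<longleftrightarrow> x \<le> ennreal (c powr (1 / a))"
proof (cases x)
  case (real y)
  have "y powr a \<le> c \<longleftrightarrow> y \<le> c powr (1 / a)"
  proof
    assume "y powr a \<le> c"
    then have "(y powr a) powr (1 / a) \<le> c powr (1 / a)" using assms by (intro powr_mono2) auto
    then show "y \<le> c powr (1 / a)" using real assms by (simp add: powr_powr)
  next
    assume "y \<le> c powr (1 / a)"
    then have "y powr a \<le> (c powr (1 / a)) powr a" using real assms by (intro powr_mono2) auto
    then show "y powr a \<le> c" using assms by (simp add: powr_powr)
  qed
  then show ?thesis using real assms by (simp add: epowr_def)
qed (simp add: epowr_def top_unique)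

lemma borel_measurable_epowr [measurable]:
  assumes [measurable]: "g \<in> borel_measurable M"
  shows "(\<lambda>x. g x powr\<^sub>e a) \<in> borel_measurable M"
proof -
  have "(\<lambda>y. y powr\<^sub>e a) \<in> borel_measurable borel"
    unfolding epowr_def by (intro measurable_If) auto
  then show ?thesis by measurable
qed

lemma Lp_norm_lborel: "Lp_norm p u = (\<integral>\<^sup>+ x. ennreal (\<bar>u x\<bar> powr p) \<partial>lborel) powr\<^sub>e (1 / p)"
  by (simp add: Lp_norm_def nn_integral_completion)

lemma Lp_norm_translate:
  assumes [measurable]: "u \<in> borel_measurable borel"
  shows "Lp_norm p (\<lambda>x. u (x + c)) = Lp_norm p u"
  unfolding Lp_norm_lborel
  using nn_integral_translate[of "\<lambda>x. ennreal (\<bar>u x\<bar> powr p)" c] by simp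

text \<open>Integrated with an optimal constant \<open>Q\<close>, this replaces Hoelder's inequality up to a factor 2.\<close>

lemma le_add_powr:
  fixes x Q p :: real
  assumes "0 \<le> x" "0 < Q" "1 \<le> p"
  shows "x \<le> Q + x powr p * Q powr (1 - p)"
proof (cases "x \<le> Q")
  case True
  then show ?thesis using assms by (simp add: add_increasing2)
next
  case False
  then have "x = x powr p * x powr (1 - p)" using assms by (simp add: powr_add[symmetric])
  also have "\<dots> \<le> x powr p * Q powr (1 - p)"
    using False assms by (intro mult_left_mono powr_mono2') auto
  finally show ?thesis using assms by simp
qed

text \<open>By \<open>le_add_powr\<close> the integral is at most
  \<open>Q * \<tau> + Q powr (1 - p) * N' powr p\<close>. The height \<open>Q\<close> that makes
  both summands equal produces the exponent of Hoelder's inequality and the factor 2.\<close>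

lemma nn_integral_set_le_Lp_norm:
  fixes u :: "real ^ 'n::finite \<Rightarrow> real"
  assumes [measurable]: "u \<in> borel_measurable borel" "E \<in> sets borel"
    and E: "emeasure lborel E = ennreal \<tau>" "0 < \<tau>" and p: "1 \<le> p"
  shows "(\<integral>\<^sup>+ x. ennreal \<bar>u x\<bar> * indicator E x \<partial>lborel) \<le> ennreal (2 * \<tau> powr (1 - 1 / p)) * Lp_norm p u"
proof (cases "Lp_norm p u")
  case (real N)
  define c where "c = 2 * \<tau> powr (1 - 1 / p)"
  have c: "c > 0" using E by (simp add: c_def)
  have "(\<integral>\<^sup>+ x. ennreal \<bar>u x\<bar> * indicator E x \<partial>lborel) \<le> ennreal (c * N) + ennreal e" if e: "0 < e" for e
  proof -
    \<comment> \<open>The margin keeps \<open>Q\<close> positive even when \<open>N = 0\<close>; its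
      size makes the error in the final bound exactly \<open>e\<close>.\<close>
    define N' where "N' = N + e / c"
    have N': "N' > 0" "N \<le> N'" using real e c by (auto simp: N'_def intro: add_nonneg_pos)
    define Q where "Q = N' * \<tau> powr (- 1 / p)"
    have Q: "Q > 0" using N' E by (simp add: Q_def)
    have int: "(\<integral>\<^sup>+ x. ennreal (\<bar>u x\<bar> powr p) \<partial>lborel) \<le> ennreal (N' powr p)"
      using epowr_le_iff[of "1 / p" N' "\<integral>\<^sup>+ x. ennreal (\<bar>u x\<bar> powr p) \<partial>lborel"] p N' real
      by (simp add: Lp_norm_lborel ennreal_leI)
    have "(\<integral>\<^sup>+ x. ennreal \<bar>u x\<bar> * indicator E x \<partial>lborel)
        \<le> (\<integral>\<^sup>+ x. ennreal Q * indicator E x + ennreal (Q powr (1 - p)) * ennreal (\<bar>u x\<bar> powr p) \<partial>lborel)"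
    proof (rule nn_integral_mono)
      fix x
      have "\<bar>u x\<bar> \<le> Q + \<bar>u x\<bar> powr p * Q powr (1 - p)" using Q p by (intro le_add_powr) auto
      then have "ennreal \<bar>u x\<bar> \<le> ennreal Q + ennreal (Q powr (1 - p)) * ennreal (\<bar>u x\<bar> powr p)"
        using Q by (simp add: ennreal_mult[symmetric] ennreal_plus[symmetric] mult.commute del: ennreal_plus)
      then show "ennreal \<bar>u x\<bar> * indicator E x
          \<le> ennreal Q * indicator E x + ennreal (Q powr (1 - p)) * ennreal (\<bar>u x\<bar> powr p)"
        by (auto split: split_indicator)
    qed
    also have "\<dots> = ennreal Q * ennreal \<tau> + ennreal (Q powr (1 - p)) * (\<integral>\<^sup>+ x. ennreal (\<bar>u x\<bar> powr p) \<partial>lborel)"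
      by (simp add: nn_integral_add nn_integral_cmult E)
    also have "\<dots> \<le> ennreal Q * ennreal \<tau> + ennreal (Q powr (1 - p)) * ennreal (N' powr p)"
      by (intro add_mono mult_left_mono int order_refl) auto
    also have "\<dots> = ennreal (Q * \<tau> + Q powr (1 - p) * N' powr p)"
      using Q E by (simp add: ennreal_mult)
    also have "Q * \<tau> + Q powr (1 - p) * N' powr p = c * N'"
    proof -
      have "Q * \<tau> = N' * \<tau> powr (1 - 1 / p)"
        using E by (simp add: Q_def powr_diff powr_minus_divide)
      moreover have "Q powr (1 - p) * N' powr p = N' * \<tau> powr (1 - 1 / p)"
      proof -
        have "Q powr (1 - p) = N' powr (1 - p) * \<tau> powr (- 1 / p * (1 - p))"
          unfolding Q_def using N' E by (simp add: powr_mult powr_powr)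
        moreover have "- 1 / p * (1 - p) = 1 - 1 / p" using p by (simp add: field_simps)
        moreover have N'_eq: "N' powr (1 - p) * N' powr p = N'" using N' by (simp add: powr_add[symmetric])
        ultimately have "Q powr (1 - p) * N' powr p = (N' powr (1 - p) * N' powr p) * \<tau> powr (1 - 1 / p)"
          by simp
        then show ?thesis by (simp only: N'_eq)
      qed
      ultimately show ?thesis by (simp add: c_def)
    qed
    also have "c * N' = c * N + e" using c by (simp add: N'_def field_simps)
    finally show ?thesis using c real e by simp
  qed
  then have "(\<integral>\<^sup>+ x. ennreal \<bar>u x\<bar> * indicator E x \<partial>lborel) \<le> ennreal (c * N)"
    by (rule ennreal_le_epsilon)
  also have "\<dots> = ennreal c * Lp_norm p u" using c real by (simp add: ennreal_mult')
  finally show ?thesis by (simp only: c_def)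
qed (use E in \<open>simp add: ennreal_mult_eq_top_iff ennreal_mult_top\<close>)

section \<open>Averages of differences over intervals and boxes\<close>

lemma borel_measurable_Lp_norm_difference [measurable]:
  fixes f :: "real ^ 'n::finite \<Rightarrow> real"
  assumes [measurable]: "f \<in> borel_measurable borel"
  shows "(\<lambda>v. Lp_norm p (difference k j v f)) \<in> borel_measurable borel"
proof -
  have "(\<lambda>(v, x). ennreal (\<bar>difference k j v f x\<bar> powr p)) \<in> borel_measurable (borel \<Otimes>\<^sub>M lborel)"
    by measurable
  from lborel.borel_measurable_nn_integral[OF this] show ?thesis
    unfolding Lp_norm_lborel by (intro borel_measurable_epowr) simp
qed

text \<open>Only steps between \<open>h\<close> and \<open>2 * h\<close> enter, where the weights
  \<open>v powr (- r)\<close> and \<open>1 / v\<close> are comparable to constants. For finite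
  \<open>\<theta>\<close>, \<open>le_add_powr\<close> with height \<open>B\<close> takes the place
  of Hoelder's inequality: the height contributes \<open>h * B\<close> and the power term at most
  \<open>2 * h * B\<close>, hence the factor 3.\<close>

lemma nn_integral_Lp_norm_difference_le:
  fixes f :: "real ^ 'n::finite \<Rightarrow> real"
  assumes [measurable]: "f \<in> borel_measurable borel"
    and r: "0 < r" and \<theta>: "1 \<le> \<theta>" and B: "0 < B" "besov_seminorm k r p \<theta> j f \<le> ennreal B" and h: "0 < h"
  shows "(\<integral>\<^sup>+ v. Lp_norm p (difference k j v f) * indicator {h..2 * h} v \<partial>lborel)
           \<le> ennreal (h * (3 * 2 powr r * h powr r * B))"
proof -
  define G where "G v = ennreal (v powr (- r)) * Lp_norm p (difference k j v f)" for v
  have [measurable]: "G \<in> borel_measurable borel" unfolding G_def by measurable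
  have le: "Lp_norm p (difference k j v f) * indicator {h..2 * h} v
      \<le> ennreal ((2 * h) powr r) * (G v * indicator {h..2 * h} v)" for v
  proof (cases "v \<in> {h..2 * h}")
    case True
    then have v: "0 < v" "v \<le> 2 * h" using h by auto
    then have "1 \<le> (2 * h) powr r * v powr (- r)"
      using r powr_mono2[of r v "2 * h"] by (simp add: powr_minus_divide)
    then have "1 * Lp_norm p (difference k j v f)
        \<le> ennreal ((2 * h) powr r * v powr (- r)) * Lp_norm p (difference k j v f)"
      by (intro mult_right_mono) auto
    then show ?thesis using True by (simp add: G_def ennreal_mult mult.assoc)
  qed simp
  have "(\<integral>\<^sup>+ v. G v * indicator {h..2 * h} v \<partial>lborel) \<le> ennreal (3 * h * B)"
  proof (cases "\<theta> = \<infinity>")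
    case True
    then have "esssup (restrict_space lborel {0<..}) G \<le> ennreal B"
      using B by (simp add: besov_seminorm_def G_def[abs_def])
    then have "AE v in restrict_space lborel {0<..}. G v \<le> ennreal B"
      by (intro eventually_mono[OF esssup_AE[of G]]) auto
    then have "AE v in lborel. v \<in> {0<..} \<longrightarrow> G v \<le> ennreal B"
      by (simp add: AE_restrict_space_iff)
    then have "(\<integral>\<^sup>+ v. G v * indicator {h..2 * h} v \<partial>lborel) \<le> (\<integral>\<^sup>+ v. ennreal B * indicator {h..2 * h} v \<partial>lborel)"
      by (intro nn_integral_mono_AE) (use h in \<open>auto elim!: eventually_mono split: split_indicator\<close>)
    also have "\<dots> = ennreal (B * h)" using h B by (simp add: nn_integral_cmult ennreal_mult)
    also have "\<dots> \<le> ennreal (3 * h * B)" using h B by (intro ennreal_leI) auto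
    finally show ?thesis .
  next
    case False
    define a where "a = enn2real \<theta>"
    have a: "1 \<le> a" using False \<theta> by (cases \<theta>) (auto simp: a_def)
    have "(\<integral>\<^sup>+ v. G v powr\<^sub>e a * ennreal (1 / v) * indicator {0<..} v \<partial>lborel) powr\<^sub>e (1 / a) \<le> ennreal B"
      using B False by (simp add: besov_seminorm_def G_def a_def)
    then have int: "(\<integral>\<^sup>+ v. G v powr\<^sub>e a * ennreal (1 / v) * indicator {0<..} v \<partial>lborel) \<le> ennreal (B powr a)"
      using a B by (subst (asm) epowr_le_iff) auto
    have "(\<integral>\<^sup>+ v. G v * indicator {h..2 * h} v \<partial>lborel)
       \<le> (\<integral>\<^sup>+ v. ennreal B * indicator {h..2 * h} v +
            ennreal (B powr (1 - a) * (2 * h)) * (G v powr\<^sub>e a * ennreal (1 / v) * indicator {0<..} v) \<partial>lborel)"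
    proof (rule nn_integral_mono)
      fix v
      show "G v * indicator {h..2 * h} v \<le> ennreal B * indicator {h..2 * h} v +
            ennreal (B powr (1 - a) * (2 * h)) * (G v powr\<^sub>e a * ennreal (1 / v) * indicator {0<..} v)"
      proof (cases "v \<in> {h..2 * h}")
        case True
        then have v: "0 < v" "v \<le> 2 * h" using h by auto
        show ?thesis
        proof (cases "G v")
          case (real g)
          have "g \<le> B + g powr a * B powr (1 - a)" using real B a by (intro le_add_powr) auto
          \<comment> \<open>The weight \<open>1 / v\<close> of the seminorm is inserted at the cost
            of \<open>2 * h\<close>, because \<open>v \<le> 2 * h\<close>.\<close>
          also have "g powr a * B powr (1 - a) \<le> B powr (1 - a) * (2 * h) * (g powr a * (1 / v))"
            using v mult_right_mono[of v "2 * h" "B powr (1 - a) * g powr a"] by (simp add: field_simps)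
          finally have "ennreal g \<le> ennreal (B + B powr (1 - a) * (2 * h) * (g powr a * (1 / v)))"
            by (simp add: ennreal_leI)
          also have "\<dots> = ennreal B + ennreal (B powr (1 - a) * (2 * h)) * (ennreal (g powr a) * ennreal (1 / v))"
            using v h B real by (simp add: ennreal_mult[symmetric] ennreal_plus[symmetric] del: ennreal_plus)
          finally show ?thesis using True v real B h by (simp add: epowr_def)
        next
          case top
          then show ?thesis using True v B h by (simp add: epowr_def ennreal_mult_eq_top_iff ennreal_mult_top ennreal_top_mult)
        qed
      qed simp
    qed
    also have "\<dots> = ennreal B * ennreal h + ennreal (B powr (1 - a) * (2 * h)) *
        (\<integral>\<^sup>+ v. G v powr\<^sub>e a * ennreal (1 / v) * indicator {0<..} v \<partial>lborel)"
      using h by (simp add: nn_integral_add nn_integral_cmult)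
    also have "\<dots> \<le> ennreal B * ennreal h + ennreal (B powr (1 - a) * (2 * h)) * ennreal (B powr a)"
      by (intro add_mono mult_left_mono int order_refl) auto
    also have "\<dots> = ennreal (B * h + B powr (1 - a) * (2 * h) * B powr a)"
      using h B by (simp add: ennreal_mult)
    also have "B * h + B powr (1 - a) * (2 * h) * B powr a = 3 * h * B"
      using B by (simp add: powr_diff)
    finally show ?thesis .
  qed
  then have "ennreal ((2 * h) powr r) * (\<integral>\<^sup>+ v. G v * indicator {h..2 * h} v \<partial>lborel)
      \<le> ennreal ((2 * h) powr r) * ennreal (3 * h * B)"
    by (intro mult_left_mono) auto
  moreover have "(\<integral>\<^sup>+ v. Lp_norm p (difference k j v f) * indicator {h..2 * h} v \<partial>lborel)
      \<le> ennreal ((2 * h) powr r) * (\<integral>\<^sup>+ v. G v * indicator {h..2 * h} v \<partial>lborel)"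
    by (subst nn_integral_cmult[symmetric]) (auto intro!: nn_integral_mono le)
  moreover have "ennreal ((2 * h) powr r) * ennreal (3 * h * B) = ennreal (h * (3 * 2 powr r * h powr r * B))"
    using h B by (simp add: ennreal_mult[symmetric] powr_mult mult_ac)
  ultimately show ?thesis by simp
qed

text \<open>The integrand is a product of functions of single coordinates: \<open>N\<close> belongs
  to coordinate \<open>j\<close>, and every other coordinate contributes only the length
  \<open>h l\<close> of its interval.\<close>

lemma nn_integral_box_coordinate_le:
  fixes N :: "real \<Rightarrow> ennreal" and h :: "'n::finite \<Rightarrow> real"
  assumes [measurable]: "N \<in> borel_measurable borel" and h: "\<And>j. 0 < h j"
    and W: "0 \<le> W" "(\<integral>\<^sup>+ v. N v * indicator {h j..2 * h j} v \<partial>lborel) \<le> ennreal (h j * W)"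
  shows "(\<integral>\<^sup>+ y. N (y $ j) * (\<Prod>l\<in>UNIV. indicator {h l..2 * h l} (y $ l)) \<partial>(lborel :: (real ^ 'n) measure))
           \<le> ennreal ((\<Prod>l\<in>UNIV. h l) * W)"
proof -
  define g where "g l v = (if l = j then N v else 1) * indicator {h l..2 * h l} v" for l v
  have [measurable]: "g l \<in> borel_measurable borel" for l unfolding g_def by (cases "l = j") auto
  have "N (y $ j) * (\<Prod>l\<in>UNIV. indicator {h l..2 * h l} (y $ l)) = (\<Prod>l\<in>UNIV. g l (y $ l))" for y :: "real ^ 'n"
    by (simp add: g_def prod.distrib prod.delta)
  then have "(\<integral>\<^sup>+ y. N (y $ j) * (\<Prod>l\<in>UNIV. indicator {h l..2 * h l} (y $ l)) \<partial>(lborel :: (real ^ 'n) measure))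
      = (\<Prod>l\<in>UNIV. \<integral>\<^sup>+ v. g l v \<partial>lborel)"
    by (simp add: nn_integral_vec_prod)
  also have "\<dots> \<le> (\<Prod>l\<in>UNIV. ennreal (h l * (if l = j then W else 1)))"
  proof (rule prod_mono_ennreal)
    fix l
    show "(\<integral>\<^sup>+ v. g l v \<partial>lborel) \<le> ennreal (h l * (if l = j then W else 1))"
      using W h[of l] by (cases "l = j") (auto simp: g_def)
  qed
  also have "\<dots> = ennreal ((\<Prod>l\<in>UNIV. h l) * W)"
    using W h by (simp add: prod_ennreal less_imp_le prod.distrib)
  finally show ?thesis .
qed

section \<open>A recursive inequality for the distribution function\<close>

text \<open>If the level set \<open>E\<close> above \<open>\<mu>'\<close> had measure
  \<open>\<tau> > t\<close>, the integral of the differences over \<open>E\<close> times the box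
  could be estimated in two ways. For each \<open>x\<close> in \<open>E\<close> at least half of the
  box is good, which bounds the integral below by \<open>\<delta> * V * \<tau> / 2\<close>.
  Integrating in \<open>x\<close> first, with Hoelder's inequality on \<open>E\<close>, gives an
  upper bound that contradicts the choice of \<open>\<mu>'\<close>. The factor \<open>M\<close>
  comes from the pointwise expansion alone, so it does not depend on the size of the box.\<close>

lemma distribution_recursion:
  fixes f :: "real ^ 'n::finite \<Rightarrow> real" and p h W :: "'n \<Rightarrow> real" and k :: "'n \<Rightarrow> nat"
  defines "I \<equiv> {i. \<forall>j. i j \<le> k j}"
  defines "M \<equiv> \<Prod>j\<in>UNIV. 2 ^ k j"
  assumes f [measurable]: "f \<in> borel_measurable borel"
    and p: "\<And>j. 1 \<le> p j" and h: "\<And>j. 0 < h j" and W: "\<And>j. 0 \<le> W j"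
    and int: "\<And>j. (\<integral>\<^sup>+ v. Lp_norm (p j) (difference (k j) j v f) * indicator {h j..2 * h j} v \<partial>lborel)
                 \<le> ennreal (h j * W j)"
    and T: "0 \<le> \<mu>" "0 \<le> T" "emeasure lborel {x. \<mu> < \<bar>f x\<bar>} \<le> ennreal T"
      "2 * real (card I) * T \<le> (\<Prod>j\<in>UNIV. h j)"
    and t: "0 < t"
    and \<mu>': "M * \<mu> + 4 * M * real CARD('n) * real (card I) * (\<Sum>j\<in>UNIV. t powr (- 1 / p j) * W j) < \<mu>'"
    and fin: "emeasure lborel {x. \<mu>' < \<bar>f x\<bar>} < \<infinity>"
  shows "emeasure lborel {x. \<mu>' < \<bar>f x\<bar>} \<le> ennreal t"
proof (rule ccontr)
  define V where "V = (\<Prod>j\<in>UNIV. h j)"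
  define n where "n = real CARD('n)"
  define L where "L = real (card I)"
  define E where "E = {x. \<mu>' < \<bar>f x\<bar>}"
  define \<tau> where "\<tau> = measure lborel E"
  \<comment> \<open>Solves \<open>M * (\<mu> + n * \<delta>) = \<mu>'\<close>, so that a point of
    \<open>E\<close> forces the differences up to \<open>\<delta>\<close>.\<close>
  define \<delta> where "\<delta> = (\<mu>' - M * \<mu>) / (M * n)"
  define D where "D j v = difference (k j) j v f" for j v
  \<comment> \<open>Summing over all directions and multiplicities makes \<open>R x y\<close> a
    common bound for every difference in the pointwise expansion.\<close>
  define R where "R x y = (\<Sum>j\<in>UNIV. \<Sum>i\<in>I. \<bar>D j (y $ j) (x + dilate i y)\<bar>)" for x y
  define Q where "Q y = (\<Prod>l\<in>UNIV. indicator {h l..2 * h l} (y $ l) :: ennreal)" for y :: "real ^ 'n"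
  define I' where "I' = {i. \<forall>j. 1 \<le> i j \<and> i j \<le> k j}"
  \<comment> \<open>The steps \<open>y\<close> for which some point shifted in every direction lies
    above level \<open>\<mu>\<close>.\<close>
  define Bad where "Bad x = (\<Union>i\<in>I'. {y. x + dilate i y \<in> {z. \<mu> < \<bar>f z\<bar>}})" for x
  assume "\<not> emeasure lborel {x. \<mu>' < \<bar>f x\<bar>} \<le> ennreal t"
  moreover have E_eq: "emeasure lborel E = ennreal \<tau>"
    using fin by (simp add: E_def \<tau>_def emeasure_eq_ennreal_measure top.not_eq_extremum)
  ultimately have \<tau>: "t < \<tau>" unfolding E_def[symmetric] by (simp add: not_le ennreal_less_iff t less_imp_le)
  have [measurable]: "E \<in> sets borel" unfolding E_def by measurable
  have V: "0 < V" unfolding V_def using h by (intro prod_pos) auto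
  have n: "1 \<le> n" by (simp add: n_def Suc_le_eq)
  have M: "1 \<le> M" unfolding M_def by (intro prod_ge_1) auto
  have "I = PiE UNIV (\<lambda>j. {..k j})" by (auto simp: I_def)
  then have finI: "finite I" by (simp add: finite_PiE)
  have I'I: "I' \<subseteq> I" by (auto simp: I_def I'_def)
  have S_nonneg: "0 \<le> (\<Sum>j\<in>UNIV. t powr (- 1 / p j) * W j)" using W by (intro sum_nonneg) auto
  have "0 \<le> 4 * M * n * L * (\<Sum>j\<in>UNIV. t powr (- 1 / p j) * W j)"
    using M n S_nonneg by (simp add: L_def)
  then have "0 < \<mu>' - M * \<mu>" using \<mu>' by (simp add: n_def L_def)
  then have \<delta>: "0 < \<delta>" using M n by (simp add: \<delta>_def)
  have [measurable]: "D j v \<in> borel_measurable borel" for j v unfolding D_def by measurable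
  have R_nonneg: "0 \<le> R x y" for x y unfolding R_def by (intro sum_nonneg) auto
  have [measurable]: "(\<lambda>z. R (fst z) (snd z)) \<in> borel_measurable (borel \<Otimes>\<^sub>M borel)"
    unfolding R_def D_def by measurable
  have [measurable]: "Q \<in> borel_measurable borel" unfolding Q_def by measurable
  have intQ: "(\<integral>\<^sup>+ y. Q y \<partial>lborel) = ennreal V"
    unfolding Q_def using h by (subst nn_integral_vec_prod) (auto simp: V_def prod_ennreal less_imp_le)
  have [measurable]: "Bad x \<in> sets borel" for x
  proof -
    have "{y. x + dilate i y \<in> {z. \<mu> < \<bar>f z\<bar>}} \<in> sets borel" for i by simp
    moreover have "finite I'" using finI I'I by (rule finite_subset[rotated])
    ultimately show ?thesis unfolding Bad_def by (intro sets.finite_UN) auto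
  qed
  \<comment> \<open>Each of the at most \<open>card I\<close> pieces has measure at most
    \<open>T\<close> by \<open>emeasure_dilate_le\<close>, and the volume of the box is at least
    \<open>2 * card I * T\<close>.\<close>
  have Bad: "emeasure lborel (Bad x) \<le> ennreal (V / 2)" for x
  proof -
    have "emeasure lborel (Bad x) \<le> (\<Sum>i\<in>I'. emeasure lborel {y. x + dilate i y \<in> {z. \<mu> < \<bar>f z\<bar>}})"
      unfolding Bad_def by (rule emeasure_subadditive_finite) (use finI I'I in \<open>auto intro: finite_subset\<close>)
    also have "\<dots> \<le> (\<Sum>i\<in>I'. ennreal T)"
    proof (rule sum_mono)
      fix i assume "i \<in> I'"
      then have "emeasure lborel {y. x + dilate i y \<in> {z. \<mu> < \<bar>f z\<bar>}} \<le> emeasure lborel {z. \<mu> < \<bar>f z\<bar>}"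
        by (intro emeasure_dilate_le) (auto simp: I'_def)
      also note T(3)
      finally show "emeasure lborel {y. x + dilate i y \<in> {z. \<mu> < \<bar>f z\<bar>}} \<le> ennreal T" .
    qed
    also have "\<dots> \<le> (\<Sum>i\<in>I. ennreal T)" using finI I'I by (intro sum_mono2) auto
    also have "\<dots> = ennreal (L * T)" using T by (simp add: L_def ennreal_mult ennreal_of_nat_eq_real_of_nat)
    also have "\<dots> \<le> ennreal (V / 2)" using T(4) by (intro ennreal_leI) (simp add: V_def L_def)
    finally show ?thesis .
  qed
  have pointwise: "\<delta> \<le> R x y" if "x \<in> E" "y \<notin> Bad x" for x y
  proof -
    have "\<bar>f x\<bar> \<le> (\<Prod>j\<in>UNIV. 2 ^ k j) * (\<mu> + real (card (UNIV :: 'n set)) * R x y)"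
    proof (rule abs_le_differences)
      fix i assume "\<And>j. j \<in> (UNIV :: 'n set) \<Longrightarrow> 1 \<le> i j \<and> i j \<le> k j"
      then have "i \<in> I'" by (auto simp: I'_def)
      then show "\<bar>f (x + dilate i y)\<bar> \<le> \<mu>" using that by (auto simp: Bad_def not_less)
    next
      fix i j assume "\<And>l. i l \<le> k l"
      then have i: "i \<in> I" by (simp add: I_def)
      have "\<bar>D j (y $ j) (x + dilate i y)\<bar> \<le> (\<Sum>i\<in>I. \<bar>D j (y $ j) (x + dilate i y)\<bar>)"
        using finI i by (intro member_le_sum) auto
      also have "\<dots> \<le> R x y" unfolding R_def by (rule member_le_sum) (auto intro: sum_nonneg)
      finally show "\<bar>difference (k j) j (y $ j) f (x + dilate i y)\<bar> \<le> R x y" by (simp add: D_def)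
    qed (use T R_nonneg in auto)
    then have "\<mu>' < M * (\<mu> + n * R x y)" using that by (simp add: E_def M_def n_def)
    then show ?thesis using M n by (simp add: \<delta>_def field_simps)
  qed
  \<comment> \<open>Off \<open>Bad x\<close> the integrand is at least
    \<open>\<delta> * Q y\<close>. The bad steps are paid for by \<open>\<delta>\<close> times their
    measure, at most half of \<open>\<delta> * V\<close>.\<close>
  have lower: "ennreal (\<delta> * V / 2) \<le> (\<integral>\<^sup>+ y. ennreal (R x y) * Q y \<partial>lborel)" if "x \<in> E" for x
  proof -
    have "ennreal \<delta> * Q y \<le> ennreal (R x y) * Q y + ennreal \<delta> * indicator (Bad x) y" for y
    proof (cases "y \<in> Bad x")
      case True
      have "Q y \<le> 1" unfolding Q_def by (intro prod_le_1) (auto split: split_indicator)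
      then have "ennreal \<delta> * Q y \<le> ennreal \<delta> * 1" by (intro mult_left_mono) auto
      then show ?thesis using True by (simp add: add_increasing)
    next
      case False
      then show ?thesis using pointwise[OF that] by (auto intro!: mult_right_mono ennreal_leI)
    qed
    then have "(\<integral>\<^sup>+ y. ennreal \<delta> * Q y \<partial>lborel)
        \<le> (\<integral>\<^sup>+ y. ennreal (R x y) * Q y + ennreal \<delta> * indicator (Bad x) y \<partial>lborel)"
      by (rule nn_integral_mono)
    also have "\<dots> = (\<integral>\<^sup>+ y. ennreal (R x y) * Q y \<partial>lborel) + ennreal \<delta> * emeasure lborel (Bad x)"
    proof -
      have [measurable]: "(\<lambda>y. R x y) \<in> borel_measurable borel"
        unfolding R_def D_def by measurable
      show ?thesis by (simp add: nn_integral_add nn_integral_cmult)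
    qed
    also have "\<dots> \<le> (\<integral>\<^sup>+ y. ennreal (R x y) * Q y \<partial>lborel) + ennreal \<delta> * ennreal (V / 2)"
      by (intro add_mono mult_left_mono Bad) auto
    finally have *: "ennreal (\<delta> * V) \<le> (\<integral>\<^sup>+ y. ennreal (R x y) * Q y \<partial>lborel) + ennreal (\<delta> * V / 2)"
      using \<delta> V by (simp add: nn_integral_cmult intQ ennreal_mult[symmetric])
    \<comment> \<open>Cancelling half of the total needs a finite integral; an infinite one
      satisfies the claim at once.\<close>
    show ?thesis
    proof (cases "\<integral>\<^sup>+ y. ennreal (R x y) * Q y \<partial>lborel")
      case (real a)
      with * have "ennreal (\<delta> * V) \<le> ennreal (a + \<delta> * V / 2)" using \<delta> V by simp
      then have "\<delta> * V \<le> a + \<delta> * V / 2" using \<delta> V real by (subst (asm) ennreal_le_iff) auto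
      then show ?thesis using real by (simp add: ennreal_leI)
    qed simp
  qed
  define N where "N j v = Lp_norm (p j) (D j v)" for j v
  have [measurable]: "N j \<in> borel_measurable borel" for j unfolding N_def D_def by measurable
  define c where "c j = 2 * \<tau> powr (1 - 1 / p j)" for j
  have c: "0 \<le> c j" for j by (simp add: c_def)
  \<comment> \<open>For fixed \<open>y\<close> the shift by \<open>dilate i y\<close> does not
    change the norm of the difference, so the sum over multiplicities only contributes the factor
    \<open>L\<close>.\<close>
  have upper: "(\<integral>\<^sup>+ x. ennreal (R x y) * indicator E x \<partial>lborel) \<le> (\<Sum>j\<in>UNIV. ennreal (L * c j) * N j (y $ j))" for y
  proof -
    have "ennreal (R x y) * indicator E x =
        (\<Sum>j\<in>UNIV. \<Sum>i\<in>I. ennreal \<bar>D j (y $ j) (x + dilate i y)\<bar> * indicator E x)" for x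
      by (cases "x \<in> E") (simp_all add: R_def sum_nonneg)
    then have "(\<integral>\<^sup>+ x. ennreal (R x y) * indicator E x \<partial>lborel) =
        (\<Sum>j\<in>UNIV. \<Sum>i\<in>I. \<integral>\<^sup>+ x. ennreal \<bar>D j (y $ j) (x + dilate i y)\<bar> * indicator E x \<partial>lborel)"
      by (simp add: nn_integral_sum)
    also have "\<dots> \<le> (\<Sum>j\<in>UNIV. \<Sum>i\<in>I. ennreal (c j) * N j (y $ j))"
    proof (intro sum_mono)
      fix j i
      have "(\<integral>\<^sup>+ x. ennreal \<bar>D j (y $ j) (x + dilate i y)\<bar> * indicator E x \<partial>lborel)
          \<le> ennreal (c j) * Lp_norm (p j) (\<lambda>x. D j (y $ j) (x + dilate i y))"
        unfolding c_def using \<tau> t p E_eq by (intro nn_integral_set_le_Lp_norm) auto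
      then show "(\<integral>\<^sup>+ x. ennreal \<bar>D j (y $ j) (x + dilate i y)\<bar> * indicator E x \<partial>lborel)
          \<le> ennreal (c j) * N j (y $ j)"
        by (simp add: Lp_norm_translate N_def)
    qed
    also have "\<dots> = (\<Sum>j\<in>UNIV. ennreal (L * c j) * N j (y $ j))"
      using c by (simp add: L_def ennreal_mult ennreal_of_nat_eq_real_of_nat mult.assoc)
    finally show ?thesis .
  qed
  have "ennreal (\<delta> * V / 2) * ennreal \<tau> = (\<integral>\<^sup>+ x. ennreal (\<delta> * V / 2) * indicator E x \<partial>lborel)"
    by (simp add: nn_integral_cmult_indicator E_eq)
  also have "\<dots> \<le> (\<integral>\<^sup>+ x. (\<integral>\<^sup>+ y. ennreal (R x y) * Q y \<partial>lborel) * indicator E x \<partial>lborel)"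
    by (intro nn_integral_mono) (auto split: split_indicator intro: lower)
  also have "\<dots> = (\<integral>\<^sup>+ x. (\<integral>\<^sup>+ y. ennreal (R x y) * Q y * indicator E x \<partial>lborel) \<partial>lborel)"
    by (intro nn_integral_cong) (auto split: split_indicator)
  also have "\<dots> = (\<integral>\<^sup>+ y. (\<integral>\<^sup>+ x. ennreal (R x y) * Q y * indicator E x \<partial>lborel) \<partial>lborel)"
    by (rule lborel_pair.Fubini'[symmetric]) (auto simp: case_prod_unfold)
  also have "\<dots> \<le> (\<integral>\<^sup>+ y. (\<Sum>j\<in>UNIV. ennreal (L * c j) * (N j (y $ j) * Q y)) \<partial>lborel)"
  proof (rule nn_integral_mono)
    fix y :: "real ^ 'n"
    have [measurable]: "(\<lambda>x. R x y) \<in> borel_measurable borel"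
      unfolding R_def D_def by measurable
    have "(\<integral>\<^sup>+ x. ennreal (R x y) * Q y * indicator E x \<partial>lborel) =
        Q y * (\<integral>\<^sup>+ x. ennreal (R x y) * indicator E x \<partial>lborel)"
      by (simp add: nn_integral_cmult[symmetric] mult_ac)
    also have "\<dots> \<le> Q y * (\<Sum>j\<in>UNIV. ennreal (L * c j) * N j (y $ j))"
      by (intro mult_left_mono upper) auto
    finally show "(\<integral>\<^sup>+ x. ennreal (R x y) * Q y * indicator E x \<partial>lborel)
        \<le> (\<Sum>j\<in>UNIV. ennreal (L * c j) * (N j (y $ j) * Q y))"
      by (simp add: sum_distrib_left mult_ac)
  qed
  also have "\<dots> = (\<Sum>j\<in>UNIV. ennreal (L * c j) * (\<integral>\<^sup>+ y. N j (y $ j) * Q y \<partial>lborel))"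
    by (simp add: nn_integral_sum nn_integral_cmult)
  also have "\<dots> \<le> (\<Sum>j\<in>UNIV. ennreal (L * c j) * ennreal (V * W j))"
    unfolding Q_def V_def using h W int
    by (intro sum_mono mult_left_mono nn_integral_box_coordinate_le) (auto simp: N_def D_def)
  also have "\<dots> = ennreal (\<Sum>j\<in>UNIV. L * c j * (V * W j))"
    using c V W by (simp add: L_def ennreal_mult[symmetric] sum_ennreal less_imp_le)
  finally have "ennreal (\<delta> * V / 2 * \<tau>) \<le> ennreal (\<Sum>j\<in>UNIV. L * c j * (V * W j))"
    using \<delta> V \<tau> t by (subst ennreal_mult) auto
  moreover have "0 \<le> (\<Sum>j\<in>UNIV. L * c j * (V * W j))"
    using c V W by (intro sum_nonneg mult_nonneg_nonneg) (auto simp: L_def less_imp_le)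
  ultimately have "\<delta> * V / 2 * \<tau> \<le> (\<Sum>j\<in>UNIV. L * c j * (V * W j))" by (simp add: ennreal_le_iff)
  \<comment> \<open>As \<open>t < \<tau>\<close> and the exponent \<open>- 1 / p j\<close> is
    negative, that power of \<open>\<tau>\<close> may be replaced by the same power of
    \<open>t\<close>; the remaining factor \<open>\<tau>\<close> cancels against the lower
    bound.\<close>
  also have "\<dots> \<le> V / 2 * \<tau> * (4 * L * (\<Sum>j\<in>UNIV. t powr (- 1 / p j) * W j))"
    unfolding sum_distrib_left
  proof (rule sum_mono)
    fix j
    have "c j = 2 * \<tau> * \<tau> powr (- 1 / p j)"
      using \<tau> t by (simp add: c_def powr_diff powr_minus_divide)
    also have "\<dots> \<le> 2 * \<tau> * t powr (- 1 / p j)"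
      using \<tau> t p[of j] by (intro mult_left_mono powr_mono2') auto
    finally have "L * c j * (V * W j) \<le> L * (2 * \<tau> * t powr (- 1 / p j)) * (V * W j)"
      using V W by (intro mult_right_mono mult_left_mono) (auto simp: L_def less_imp_le)
    then show "L * c j * (V * W j) \<le> V / 2 * \<tau> * (4 * L * (t powr (- 1 / p j) * W j))"
      by (simp add: mult_ac)
  qed
  finally have "(V / 2 * \<tau>) * \<delta> \<le> (V / 2 * \<tau>) * (4 * L * (\<Sum>j\<in>UNIV. t powr (- 1 / p j) * W j))"
    by (simp add: mult_ac)
  then have "\<delta> \<le> 4 * L * (\<Sum>j\<in>UNIV. t powr (- 1 / p j) * W j)"
    using V \<tau> t by (subst (asm) mult_le_cancel_left_pos) auto
  then have "\<mu>' - M * \<mu> \<le> M * n * (4 * L * (\<Sum>j\<in>UNIV. t powr (- 1 / p j) * W j))"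
    using M n by (simp add: \<delta>_def field_simps)
  then show False using \<mu>' by (simp add: n_def L_def mult_ac)
qed

text \<open>The box gets volume \<open>K * t\<close>, exactly what
  \<open>distribution_recursion\<close> needs for \<open>T = \<xi> * t\<close>, and sides for which
  every direction contributes a multiple of the same quantity
  \<open>D * t powr (r / n - 1 / p)\<close>. The dependence on \<open>\<xi>\<close> goes into
  \<open>C\<close> only.\<close>

lemma distribution_step:
  fixes rv pv :: "'n::finite \<Rightarrow> real" and \<theta> :: "'n \<Rightarrow> ennreal" and k :: "'n \<Rightarrow> nat" and n r p \<xi> :: real
  defines "M \<equiv> \<Prod>j\<in>UNIV. 2 ^ k j"
  assumes n_eq: "n = real CARD('n)"
    and rv_pos: "\<And>j. 0 < rv j"
    and pv_ge: "\<And>j. 1 \<le> pv j"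
    and \<theta>_ge: "\<And>j. 1 \<le> \<theta> j"
    and r_eq: "r = n * inverse (\<Sum>j\<in>UNIV. 1 / rv j)"
    and p_eq: "p = (n / r) * inverse (\<Sum>j\<in>UNIV. 1 / (pv j * rv j))"
    and \<xi>: "0 < \<xi>"
  shows "\<exists>C\<ge>0. \<forall>(f :: real ^ 'n \<Rightarrow> real) B \<mu> t.
      f \<in> borel_measurable borel \<longrightarrow> (\<forall>y>0. emeasure lborel {x. y < \<bar>f x\<bar>} < \<infinity>) \<longrightarrow>
      (\<forall>j. 0 < B j \<and> besov_seminorm (k j) (rv j) (pv j) (\<theta> j) j f \<le> ennreal (B j)) \<longrightarrow>
      0 \<le> \<mu> \<longrightarrow> 0 < t \<longrightarrow> emeasure lborel {x. \<mu> < \<bar>f x\<bar>} \<le> ennreal (\<xi> * t) \<longrightarrow>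
      emeasure lborel {x. M * \<mu> + C * (\<Prod>j\<in>UNIV. B j powr (r / (n * rv j))) * t powr (r / n - 1 / p) < \<bar>f x\<bar>}
        \<le> ennreal t"
proof -
  define I where "I = {i. \<forall>j. i j \<le> k j}"
  define L where "L = real (card I)"
  define K where "K = 2 * L * \<xi>"
  define \<beta> where "\<beta> j = (1 / rv j) * (r / n + 1 / pv j - 1 / p)" for j
  define C0 where "C0 = 4 * M * n * L * (\<Sum>j\<in>UNIV. 3 * 2 powr rv j * K powr (r / n + 1 / pv j - 1 / p))"
  define S where "S = (\<Sum>j\<in>UNIV. 1 / rv j)"
  define S2 where "S2 = (\<Sum>j\<in>UNIV. 1 / (pv j * rv j))"
  have n: "0 < n" by (simp add: n_eq)
  have pv: "0 < pv j" for j using pv_ge[of j] by simp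
  have S: "0 < S" unfolding S_def using rv_pos by (intro sum_pos) auto
  have S2: "0 < S2" unfolding S2_def using rv_pos pv by (intro sum_pos) auto
  have r: "0 < r" using n S by (simp add: r_eq S_def[symmetric])
  have S_eq: "S = n / r" using S n by (simp add: r_eq S_def[symmetric] field_simps)
  have p_inv: "1 / p = r / n * S2" using S2 r n by (simp add: p_eq S2_def[symmetric] field_simps)
  \<comment> \<open>The means defining \<open>r\<close> and \<open>p\<close> read
    \<open>S = n / r\<close> and \<open>1 / p = r / n * S2\<close>, so the terms with
    \<open>S2\<close> cancel and 1 remains.\<close>
  have "(\<Sum>j\<in>UNIV. \<beta> j) = (\<Sum>j\<in>UNIV. (r / n - 1 / p) * (1 / rv j) + 1 / (pv j * rv j))"
    by (intro sum.cong) (auto simp: \<beta>_def algebra_simps)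
  also have "\<dots> = (r / n - 1 / p) * S + S2"
    by (simp add: sum.distrib sum_distrib_left S_def S2_def)
  also have "\<dots> = 1" unfolding p_inv S_eq using r n by (simp add: field_simps)
  finally have sum_\<beta>: "(\<Sum>j\<in>UNIV. \<beta> j) = 1" .
  have "I = PiE UNIV (\<lambda>j. {..k j})" by (auto simp: I_def)
  then have "finite I" by (simp add: finite_PiE)
  moreover have "(\<lambda>_. 0) \<in> I" by (simp add: I_def)
  ultimately have L: "0 < L" by (auto simp: L_def card_gt_0_iff)
  have K: "0 < K" using L \<xi> by (simp add: K_def)
  have M: "1 \<le> M" unfolding M_def by (intro prod_ge_1) auto
  have C0: "0 \<le> C0" using M n L by (auto simp: C0_def intro!: mult_nonneg_nonneg sum_nonneg)
  \<comment> \<open>The constant is \<open>C0 + 1\<close> because the recursion asks for a strict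
    inequality; as \<open>D\<close> is positive, the extra summand provides it.\<close>
  show ?thesis
  proof (intro exI[of _ "C0 + 1"] conjI allI impI)
    fix f :: "real ^ 'n \<Rightarrow> real" and B :: "'n \<Rightarrow> real" and \<mu> t :: real
    assume f: "f \<in> borel_measurable borel" and fin: "\<forall>y>0. emeasure lborel {x. y < \<bar>f x\<bar>} < \<infinity>"
      and B: "\<forall>j. 0 < B j \<and> besov_seminorm (k j) (rv j) (pv j) (\<theta> j) j f \<le> ennreal (B j)"
      and \<mu>: "0 \<le> \<mu>" and t: "0 < t" and d: "emeasure lborel {x. \<mu> < \<bar>f x\<bar>} \<le> ennreal (\<xi> * t)"
    define D where "D = (\<Prod>j\<in>UNIV. B j powr (r / (n * rv j)))"
    have Bj: "0 < B j" for j using B by auto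
    have D: "0 < D" unfolding D_def by (intro prod_pos) (simp add: Bj[THEN less_imp_neq[THEN not_sym]])
    \<comment> \<open>The first factor distributes the volume \<open>K * t\<close> over the
      directions. The second, raised to the power \<open>rv j\<close>, turns \<open>B j\<close> into
      the common \<open>D\<close>, and its product over all directions is 1.\<close>
    define h where "h j = (K * t) powr \<beta> j * (D / B j) powr (1 / rv j)" for j
    have h: "0 < h j" for j using K t D Bj[of j] by (simp add: h_def less_imp_neq[THEN not_sym])
    define W where "W j = 3 * 2 powr rv j * h j powr rv j * B j" for j
    have W_eq: "W j = 3 * 2 powr rv j * (K * t) powr (r / n + 1 / pv j - 1 / p) * D" for j
    proof -
      have "h j powr rv j = (K * t) powr (\<beta> j * rv j) * (D / B j)"
        using K t D Bj[of j] rv_pos[of j] by (simp add: h_def powr_mult powr_powr)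
      moreover have "\<beta> j * rv j = r / n + 1 / pv j - 1 / p" using rv_pos[of j] by (simp add: \<beta>_def)
      ultimately show ?thesis using Bj[of j] by (simp add: W_def)
    qed
    have "(\<Prod>j\<in>UNIV. h j) = (\<Prod>j\<in>UNIV. (K * t) powr \<beta> j) * (\<Prod>j\<in>UNIV. D powr (1 / rv j)) / (\<Prod>j\<in>UNIV. B j powr (1 / rv j))"
      using D Bj by (simp add: h_def powr_divide less_imp_le prod.distrib prod_dividef)
    also have "(\<Prod>j\<in>UNIV. (K * t) powr \<beta> j) = K * t"
      using K t by (simp add: powr_sum[symmetric] sum_\<beta>)
    also have "(\<Prod>j\<in>UNIV. D powr (1 / rv j)) = D powr (n / r)"
      using D by (simp only: S_eq[symmetric] S_def powr_sum)
    also have "(\<Prod>j\<in>UNIV. B j powr (1 / rv j)) = D powr (n / r)"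
    proof -
      have "D powr (n / r) = (\<Prod>j\<in>UNIV. (B j powr (r / (n * rv j))) powr (n / r))"
        unfolding D_def by (rule prod_powr_distrib)
      also have "\<dots> = (\<Prod>j\<in>UNIV. B j powr (1 / rv j))"
        using n r by (simp add: powr_powr)
      finally show ?thesis by simp
    qed
    finally have prod_h: "(\<Prod>j\<in>UNIV. h j) = K * t" using D by simp
    have tW: "t powr (- 1 / pv j) * W j = 3 * 2 powr rv j * K powr (r / n + 1 / pv j - 1 / p) * (D * t powr (r / n - 1 / p))" for j
    proof -
      have "t powr (- 1 / pv j) * t powr (r / n + 1 / pv j - 1 / p) = t powr (r / n - 1 / p)"
        using t by (simp add: powr_add[symmetric])
      then show ?thesis using K t by (simp add: W_eq powr_mult mult_ac)
    qed
    let ?\<mu>' = "M * \<mu> + (C0 + 1) * D * t powr (r / n - 1 / p)"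
    have pos: "0 < D * t powr (r / n - 1 / p)" using D t by simp
    show "emeasure lborel {x. M * \<mu> + (C0 + 1) * (\<Prod>j\<in>UNIV. B j powr (r / (n * rv j))) * t powr (r / n - 1 / p) < \<bar>f x\<bar>}
        \<le> ennreal t"
      unfolding D_def[symmetric]
    proof (rule distribution_recursion[where k = k and p = pv and h = h and W = W and \<mu> = \<mu> and T = "\<xi> * t"])
      show "(\<integral>\<^sup>+ v. Lp_norm (pv j) (difference (k j) j v f) * indicator {h j..2 * h j} v \<partial>lborel) \<le> ennreal (h j * W j)" for j
        unfolding W_def using f rv_pos \<theta>_ge B h by (intro nn_integral_Lp_norm_difference_le[where \<theta> = "\<theta> j"]) auto
      show "2 * real (card {i. \<forall>j. i j \<le> k j}) * (\<xi> * t) \<le> (\<Prod>j\<in>UNIV. h j)"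
        unfolding prod_h by (simp add: K_def L_def I_def)
      have "4 * M * n * L * (\<Sum>j\<in>UNIV. t powr (- 1 / pv j) * W j) = C0 * (D * t powr (r / n - 1 / p))"
        unfolding tW sum_distrib_right[symmetric] by (simp add: C0_def)
      also have "\<dots> < (C0 + 1) * (D * t powr (r / n - 1 / p))"
        using pos by (intro mult_strict_right_mono) auto
      finally show "(\<Prod>j\<in>UNIV. 2 ^ k j) * \<mu> + 4 * (\<Prod>j\<in>UNIV. 2 ^ k j) * real CARD('n) * real (card {i. \<forall>j. i j \<le> k j}) *
          (\<Sum>j\<in>UNIV. t powr (- 1 / pv j) * W j) < ?\<mu>'"
        by (simp add: M_def n_eq L_def I_def mult.assoc)
      have "0 < ?\<mu>'" using M \<mu> C0 pos by (intro add_nonneg_pos) (auto simp: mult.assoc)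
      then show "emeasure lborel {x. ?\<mu>' < \<bar>f x\<bar>} < \<infinity>" using fin by blast
      show "0 \<le> W j" for j using Bj[of j] by (simp add: W_def)
    qed (use f pv_ge h \<mu> \<xi> t d in auto)
  qed (use C0 in auto)
qed

section \<open>Iteration of the recursive inequality\<close>

text \<open>The inequality is applied along \<open>t = \<xi> powr (- i)\<close>. Each step
  multiplies the level by \<open>M\<close> and adds \<open>c * \<xi> powr (a * i)\<close>. Since
  \<open>2 * M \<le> \<xi> powr b\<close>, \<open>a \<le> b\<close> and the level contains
  \<open>2 * c\<close>, each of the two parts is at most half of the next level
  \<open>\<xi> powr (b * i) * (\<mu>0 + 2 * c)\<close>.\<close>

lemma distribution_iterate:
  fixes d :: "real \<Rightarrow> ennreal" and M \<xi> a b c \<mu>0 t :: real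
  assumes step: "\<And>\<mu> t. 0 \<le> \<mu> \<Longrightarrow> 0 < t \<Longrightarrow> d \<mu> \<le> ennreal (\<xi> * t) \<Longrightarrow> d (M * \<mu> + c * t powr (- a)) \<le> ennreal t"
    and anti: "\<And>\<mu> \<mu>'. \<mu> \<le> \<mu>' \<Longrightarrow> d \<mu>' \<le> d \<mu>"
    and \<mu>0: "0 \<le> \<mu>0" "d \<mu>0 \<le> 1" and c: "0 \<le> c" and \<xi>: "1 < \<xi>" and b: "a \<le> b" "0 < b" "2 * M \<le> \<xi> powr b"
    and t: "0 < t" "t \<le> 1"
  shows "d ((\<xi> / t) powr b * (\<mu>0 + 2 * c)) < ennreal t"
proof -
  have iter: "d (\<xi> powr (b * real i) * (\<mu>0 + 2 * c)) \<le> ennreal (\<xi> powr (- real i))" for i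
  proof (induction i)
    case 0
    have "d (\<mu>0 + 2 * c) \<le> d \<mu>0" using c by (intro anti) auto
    then show ?case using \<mu>0 \<xi> by (auto intro: order_trans)
  next
    case (Suc i)
    define Z where "Z = \<mu>0 + 2 * c"
    have Z: "0 \<le> Z" "2 * c \<le> Z" using \<mu>0 c by (auto simp: Z_def)
    define u where "u = \<xi> powr (- real (Suc i))"
    have u: "0 < u" using \<xi> by (simp add: u_def)
    have "\<xi> * u = \<xi> powr (- real i)"
      using \<xi> powr_mult_base[of \<xi> "- real (Suc i)"] by (simp add: u_def)
    then have "d (M * (\<xi> powr (b * real i) * Z) + c * u powr (- a)) \<le> ennreal u"
      using Suc u Z by (intro step) (auto simp: Z_def)
    moreover have "M * (\<xi> powr (b * real i) * Z) + c * u powr (- a) \<le> \<xi> powr (b * real (Suc i)) * Z"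
    proof -
      have eq: "\<xi> powr (b * real (Suc i)) = \<xi> powr b * \<xi> powr (b * real i)"
        by (simp add: powr_add[symmetric] algebra_simps)
      have "2 * M * (\<xi> powr (b * real i) * Z) \<le> \<xi> powr b * (\<xi> powr (b * real i) * Z)"
        using b Z by (intro mult_right_mono) auto
      then have 1: "2 * (M * (\<xi> powr (b * real i) * Z)) \<le> \<xi> powr (b * real (Suc i)) * Z"
        unfolding eq by (simp add: mult_ac)
      have "u powr (- a) = \<xi> powr (a * real (Suc i))" by (simp add: u_def powr_powr algebra_simps)
      also have "\<dots> \<le> \<xi> powr (b * real (Suc i))" using \<xi> b by (intro powr_mono mult_right_mono) auto
      finally have "2 * c * u powr (- a) \<le> Z * \<xi> powr (b * real (Suc i))"
        using Z c by (intro mult_mono) auto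
      with 1 show ?thesis by (simp add: mult_ac)
    qed
    ultimately show ?case unfolding u_def Z_def by (blast intro: order_trans anti)
  qed
  define l where "l = - log \<xi> t"
  have l: "0 \<le> l" "t = \<xi> powr (- l)" using t \<xi> by (auto simp: l_def log_le_zero_cancel_iff)
  \<comment> \<open>Rounding strictly up gives \<open>\<xi> powr (- i) < t\<close>, the strictness
    needed for rearrangements; as \<open>i \<le> l + 1\<close>, it costs at most a factor
    \<open>\<xi> powr b\<close>.\<close>
  define i where "i = nat \<lfloor>l\<rfloor> + 1"
  have i: "l < real i" "real i \<le> l + 1" using l by (auto simp: i_def) linarith+
  have "d ((\<xi> / t) powr b * (\<mu>0 + 2 * c)) \<le> d (\<xi> powr (b * real i) * (\<mu>0 + 2 * c))"
  proof (intro anti mult_right_mono)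
    have "\<xi> / t = \<xi> powr (l + 1)"
      unfolding l(2) using \<xi> by (simp add: powr_minus_divide powr_add)
    then have "(\<xi> / t) powr b = \<xi> powr (b * (l + 1))" by (simp add: powr_powr mult.commute)
    then show "\<xi> powr (b * real i) \<le> (\<xi> / t) powr b" using \<xi> b i by simp
  qed (use \<mu>0 c in auto)
  also note iter
  also have "ennreal (\<xi> powr (- real i)) < ennreal t"
    unfolding l(2) using i \<xi> by (intro ennreal_lessI) auto
  finally show ?thesis .
qed

section \<open>Rearrangements, weak-type bounds and the Lorentz norm\<close>

text \<open>A set of measure \<open>t\<close> does not fit into a level set of smaller measure. With
  equality the level set itself would be a competitor in the supremum.\<close>

lemma rearrangement_le:
  fixes f :: "real ^ 'n::finite \<Rightarrow> real"
  assumes "emeasure lebesgue {x. \<mu> < \<bar>f x\<bar>} < ennreal t" "{x. \<mu> < \<bar>f x\<bar>} \<in> sets lebesgue"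
  shows "rearrangement f t \<le> ennreal \<mu>"
  unfolding rearrangement_def
proof (rule SUP_least)
  fix E :: "(real ^ 'n) set" assume "E \<in> {E \<in> sets lebesgue. emeasure lebesgue E = ennreal t}"
  then have E: "E \<in> sets lebesgue" "emeasure lebesgue E = ennreal t" by auto
  have "\<not> E \<subseteq> {x. \<mu> < \<bar>f x\<bar>}"
    using emeasure_mono[of E "{x. \<mu> < \<bar>f x\<bar>}" lebesgue] assms E by auto
  then obtain x where "x \<in> E" "\<bar>f x\<bar> \<le> \<mu>" by force
  then show "(INF x\<in>E. ennreal \<bar>f x\<bar>) \<le> ennreal \<mu>" by (intro INF_lower2 ennreal_leI)
qed

lemma sets_lebesgue_abs_greater:
  fixes f :: "'a::euclidean_space \<Rightarrow> real"
  assumes [measurable]: "f \<in> borel_measurable lebesgue"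
  shows "{x. y < \<bar>f x\<bar>} \<in> sets lebesgue"
proof -
  have "{x \<in> space lebesgue. y < \<bar>f x\<bar>} \<in> sets lebesgue" by measurable
  then show ?thesis by simp
qed

lemma emeasure_Lp_norm_le:
  fixes u :: "real ^ 'n::finite \<Rightarrow> real"
  assumes [measurable]: "u \<in> borel_measurable lebesgue"
    and p: "0 < p" and N: "0 \<le> N" "Lp_norm p u \<le> ennreal N" and y: "0 < y"
  shows "emeasure lebesgue {x. y < \<bar>u x\<bar>} \<le> ennreal ((N / y) powr p)"
proof -
  have int: "(\<integral>\<^sup>+ x. ennreal (\<bar>u x\<bar> powr p) \<partial>lebesgue) \<le> ennreal (N powr p)"
    using N p by (simp add: Lp_norm_def epowr_le_iff)
  define F where "F x = ennreal (\<bar>u x\<bar> powr p)" for x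
  have [measurable]: "F \<in> borel_measurable lebesgue" unfolding F_def by measurable
  have "{x. y < \<bar>u x\<bar>} \<subseteq> {x \<in> space lebesgue. 1 \<le> ennreal (y powr (- p)) * F x}"
  proof
    fix x assume "x \<in> {x. y < \<bar>u x\<bar>}"
    then have "y powr p \<le> \<bar>u x\<bar> powr p" using y p by (intro powr_mono2) auto
    then have "1 \<le> y powr (- p) * \<bar>u x\<bar> powr p" using y by (simp add: powr_minus_divide)
    then show "x \<in> {x \<in> space lebesgue. 1 \<le> ennreal (y powr (- p)) * F x}"
      by (simp add: F_def ennreal_mult[symmetric])
  qed
  then have "emeasure lebesgue {x. y < \<bar>u x\<bar>}
      \<le> emeasure lebesgue {x \<in> space lebesgue. 1 \<le> ennreal (y powr (- p)) * F x}"
    by (rule emeasure_mono) measurable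
  also have "\<dots> \<le> ennreal (y powr (- p)) * (\<integral>\<^sup>+ x. F x * indicator (space lebesgue) x \<partial>lebesgue)"
    by (rule nn_integral_Markov_inequality) measurable
  also have "\<dots> \<le> ennreal (y powr (- p)) * ennreal (N powr p)"
    using int by (intro mult_left_mono) (simp_all add: F_def)
  also have "\<dots> = ennreal ((N / y) powr p)"
    using N y by (simp add: ennreal_mult[symmetric] powr_divide powr_minus_divide)
  finally show ?thesis .
qed

text \<open>Where the sum exceeds \<open>2 * y\<close> in absolute value, one summand exceeds
  \<open>y\<close>, and Chebyshev's inequality applies with exponents 1 and \<open>p\<close>. For
  \<open>t \<ge> 1\<close> the decay \<open>min 1 (1 / p)\<close> is slow enough for both. The bound
  \<open>t / 2\<close> leaves room for the strict inequality in
  \<open>rearrangement_le\<close>.\<close>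

lemma distribution_L1_plus_Lp_le:
  fixes f :: "real ^ 'n::finite \<Rightarrow> real"
  assumes [measurable]: "f \<in> borel_measurable lebesgue" "g \<in> borel_measurable lebesgue" "h \<in> borel_measurable lebesgue"
    and fgh: "AE x in lebesgue. f x = g x + h x"
    and p: "0 < p" and A: "0 < A" "Lp_norm 1 g + Lp_norm p h \<le> ennreal A" and t: "1 \<le> t"
  shows "emeasure lebesgue {x. (8 + 2 * 4 powr (1 / p)) * A * t powr (- min 1 (1 / p)) < \<bar>f x\<bar>} \<le> ennreal (t / 2)"
proof -
  define b where "b = min 1 (1 / p)"
  \<comment> \<open>An exponent \<open>s\<close> needs \<open>2 * 4 powr (1 / s) \<le> c\<close> to
    bring its contribution down to \<open>t / 4\<close>; the summand 8 is the case
    \<open>s = 1\<close>.\<close>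
  define c where "c = 8 + 2 * 4 powr (1 / p)"
  define y where "y = c * A * t powr (- b) / 2"
  have c: "0 < c" by (simp add: c_def add_pos_pos)
  have y: "0 < y" using c A t by (simp add: y_def)
  have small: "((A / y) powr s) \<le> t / 4" if "0 < s" "b * s \<le> 1" "2 * 4 powr (1 / s) \<le> c" for s
  proof -
    have "A / y = (2 / c) * t powr b" using A c t by (simp add: y_def powr_minus field_simps)
    then have "(A / y) powr s = (2 / c) powr s * t powr (b * s)"
      using c t by (simp only: powr_mult powr_powr)
    also have "\<dots> \<le> (1 / 4) * t"
    proof (rule mult_mono)
      have "2 / c \<le> 2 / (2 * 4 powr (1 / s))" using that c by (intro divide_left_mono) auto
      then have "2 / c \<le> 4 powr (- (1 / s))" by (simp add: powr_minus field_simps)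
      then have "(2 / c) powr s \<le> (4 powr (- (1 / s))) powr s" using that c by (intro powr_mono2) auto
      also have "\<dots> = 4 powr (- 1)" unfolding powr_powr using that by simp
      finally show "(2 / c) powr s \<le> 1 / 4" by (simp add: powr_minus_divide)
      show "t powr (b * s) \<le> t" using t that powr_mono[of "b * s" 1 t] by simp
    qed auto
    finally show ?thesis by simp
  qed
  have b1: "b * 1 \<le> 1" by (simp add: b_def)
  have bp: "b * p \<le> 1" using p by (simp add: b_def min_def field_simps)
  have Ng: "Lp_norm 1 g \<le> ennreal A" using A(2) by (auto intro: order_trans[rotated])
  have Nh: "Lp_norm p h \<le> ennreal A" using A(2) by (auto intro: order_trans[rotated])
  have "emeasure lebesgue {x. 2 * y < \<bar>f x\<bar>} \<le> emeasure lebesgue ({x. y < \<bar>g x\<bar>} \<union> {x. y < \<bar>h x\<bar>})"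
    by (rule emeasure_mono_AE) (use fgh in \<open>auto elim!: eventually_mono intro!: sets.Un sets_lebesgue_abs_greater\<close>)
  also have "\<dots> \<le> emeasure lebesgue {x. y < \<bar>g x\<bar>} + emeasure lebesgue {x. y < \<bar>h x\<bar>}"
    by (rule emeasure_subadditive) (auto intro: sets_lebesgue_abs_greater)
  also have "\<dots> \<le> ennreal ((A / y) powr 1) + ennreal ((A / y) powr p)"
    using A Ng Nh p y by (intro add_mono emeasure_Lp_norm_le) auto
  also have "\<dots> \<le> ennreal (t / 4) + ennreal (t / 4)"
  proof (intro add_mono ennreal_leI small)
    show "2 * 4 powr (1 / 1) \<le> c" "2 * 4 powr (1 / p) \<le> c" by (simp_all add: c_def)
  qed (use p b1 bp in auto)
  also have "\<dots> = ennreal (t / 2)" using t by (simp add: ennreal_plus[symmetric] del: ennreal_plus)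
  finally have "emeasure lebesgue {x. 2 * y < \<bar>f x\<bar>} \<le> ennreal (t / 2)" .
  moreover have "2 * y = (8 + 2 * 4 powr (1 / p)) * A * t powr (- min 1 (1 / p))"
    by (simp add: y_def c_def b_def)
  ultimately show ?thesis by (simp only:)
qed

text \<open>The majorant is integrable against the Lorentz weight near 0 because
  \<open>a < 1 / q\<close> and near infinity because \<open>1 / q < b\<close>. The integral depends
  on the exponents only, so the constant is fixed before \<open>f\<close>.\<close>

lemma lorentz_norm_le:
  fixes q s a b :: real
  assumes s: "0 < s" and a: "a < 1 / q" and b: "1 / q < b"
  shows "\<exists>C\<ge>0. \<forall>(f :: real ^ 'n::finite \<Rightarrow> real) Z. 0 \<le> Z \<longrightarrow>
    (\<forall>t>0. rearrangement f t \<le> ennreal (Z * (if t \<le> 1 then t powr (- a) else t powr (- b)))) \<longrightarrow>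
    lorentz_norm q s f \<le> ennreal (C * Z)"
proof -
  define \<phi> where "\<phi> t = (if t \<le> 1 then t powr (- a) else t powr (- b))" for t :: real
  define \<psi> where "\<psi> t = (t powr (1 / q) * \<phi> t) powr s * (1 / t)" for t :: real
  \<comment> \<open>The summands are the integrals of \<open>\<psi>\<close> over
    \<open>{0..1}\<close> and over \<open>{1..}\<close>.\<close>
  define J where "J = 1 / (s * (1 / q - a)) + 1 / (s * (b - 1 / q))"
  have J: "0 \<le> J" unfolding J_def using s a b by (intro add_nonneg_nonneg divide_nonneg_nonneg mult_nonneg_nonneg) auto
  have [measurable]: "\<phi> \<in> borel_measurable borel" unfolding \<phi>_def by measurable
  have "(\<integral>\<^sup>+ t. ennreal (\<psi> t) * indicator {0<..} t \<partial>lborel)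
      \<le> (\<integral>\<^sup>+ t. ennreal (t powr (s * (1 / q - a) - 1)) * indicator {0..1} t +
               ennreal (t powr (- s * (b - 1 / q) - 1)) * indicator {1..} t \<partial>lborel)"
  proof (rule nn_integral_mono)
    fix t :: real
    show "ennreal (\<psi> t) * indicator {0<..} t \<le> ennreal (t powr (s * (1 / q - a) - 1)) * indicator {0..1} t +
               ennreal (t powr (- s * (b - 1 / q) - 1)) * indicator {1..} t"
    proof (cases "0 < t")
      case True
      have pow: "(t powr (1 / q) * t powr (- e)) powr s * (1 / t) = t powr (s * (1 / q - e) - 1)" for e
      proof -
        have "t powr (1 / q) * t powr (- e) = t powr (1 / q - e)" by (simp add: powr_add[symmetric])
        then show ?thesis
          using True by (simp add: powr_powr powr_diff[of t "s * (1 / q - e)"] mult.commute)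
      qed
      have "- s * (b - 1 / q) - 1 = s * (1 / q - b) - 1" by (simp add: algebra_simps)
      then have "\<psi> t = (if t \<le> 1 then t powr (s * (1 / q - a) - 1) else t powr (- s * (b - 1 / q) - 1))"
        by (cases "t \<le> 1") (simp_all only: \<psi>_def \<phi>_def if_True if_False pow)
      then show ?thesis using True by (auto split: split_indicator)
    qed simp
  qed
  also have "\<dots> = (\<integral>\<^sup>+ t. ennreal (t powr (s * (1 / q - a) - 1)) * indicator {0..1} t \<partial>lborel) +
               (\<integral>\<^sup>+ t. ennreal (t powr (- s * (b - 1 / q) - 1)) * indicator {1..} t \<partial>lborel)"
    by (rule nn_integral_add) auto
  also have "(\<integral>\<^sup>+ t. ennreal (t powr (s * (1 / q - a) - 1)) * indicator {0..1} t \<partial>lborel) = ennreal (1 / (s * (1 / q - a)))"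
    using has_integral_powr_from_0[of "s * (1 / q - a) - 1" 1] s a
    by (intro nn_integral_has_integral_lebesgue') auto
  also have "(\<integral>\<^sup>+ t. ennreal (t powr (- s * (b - 1 / q) - 1)) * indicator {1..} t \<partial>lborel) = ennreal (1 / (s * (b - 1 / q)))"
  proof (rule nn_integral_has_integral_lebesgue')
    have "0 < s * (b - 1 / q)" using s b by simp
    then show "((\<lambda>t. t powr (- s * (b - 1 / q) - 1)) has_integral 1 / (s * (b - 1 / q))) {1..}"
      using has_integral_powr_to_inf[of "- s * (b - 1 / q) - 1" 1] by simp
  qed auto
  also have "ennreal (1 / (s * (1 / q - a))) + ennreal (1 / (s * (b - 1 / q))) = ennreal J"
    unfolding J_def using s a b by (intro ennreal_plus[symmetric]) auto
  finally have int: "(\<integral>\<^sup>+ t. ennreal (\<psi> t) * indicator {0<..} t \<partial>lborel) \<le> ennreal J" .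
  show ?thesis
  proof (intro exI[of _ "J powr (1 / s)"] conjI allI impI)
    fix f :: "real ^ 'n \<Rightarrow> real" and Z :: real
    assume Z: "0 \<le> Z" and
      "\<forall>t>0. rearrangement f t \<le> ennreal (Z * (if t \<le> 1 then t powr (- a) else t powr (- b)))"
    then have f: "rearrangement f t \<le> ennreal (Z * \<phi> t)" if "0 < t" for t using that by (simp add: \<phi>_def)
    have \<phi>: "0 \<le> \<phi> t" for t by (simp add: \<phi>_def)
    have "(\<integral>\<^sup>+ t. (ennreal (t powr (1 / q)) * rearrangement f t) powr\<^sub>e s * ennreal (1 / t) * indicator {0<..} t \<partial>lborel)
        \<le> (\<integral>\<^sup>+ t. ennreal (Z powr s) * (ennreal (\<psi> t) * indicator {0<..} t) \<partial>lborel)"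
    proof (rule nn_integral_mono)
      fix t :: real
      show "(ennreal (t powr (1 / q)) * rearrangement f t) powr\<^sub>e s * ennreal (1 / t) * indicator {0<..} t
          \<le> ennreal (Z powr s) * (ennreal (\<psi> t) * indicator {0<..} t)"
      proof (cases "0 < t")
        case True
        define w where "w = t powr (1 / q) * (Z * \<phi> t)"
        have w: "0 \<le> w" using Z \<phi> by (simp add: w_def)
        have "ennreal (t powr (1 / q)) * rearrangement f t \<le> ennreal (t powr (1 / q)) * ennreal (Z * \<phi> t)"
          using f[OF True] by (intro mult_left_mono) auto
        also have "\<dots> = ennreal w" using Z \<phi> by (simp add: w_def ennreal_mult)
        finally have "ennreal (t powr (1 / q)) * rearrangement f t \<le> ennreal ((w powr s) powr (1 / s))"
          using w s by (simp add: powr_powr)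
        then have "(ennreal (t powr (1 / q)) * rearrangement f t) powr\<^sub>e s \<le> ennreal (w powr s)"
          using s by (subst epowr_le_iff) auto
        then have "(ennreal (t powr (1 / q)) * rearrangement f t) powr\<^sub>e s * ennreal (1 / t) \<le> ennreal (w powr s) * ennreal (1 / t)"
          by (intro mult_right_mono) auto
        also have "\<dots> = ennreal (w powr s * (1 / t))" using True by (intro ennreal_mult[symmetric]) auto
        also have "w powr s * (1 / t) = Z powr s * \<psi> t"
          using Z \<phi> by (simp add: w_def \<psi>_def powr_mult)
        also have "ennreal \<dots> = ennreal (Z powr s) * ennreal (\<psi> t)"
          using True by (intro ennreal_mult) (auto simp: \<psi>_def)
        finally show ?thesis using True by simp
      qed simp
    qed
    also have "\<dots> = ennreal (Z powr s) * (\<integral>\<^sup>+ t. ennreal (\<psi> t) * indicator {0<..} t \<partial>lborel)"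
      by (rule nn_integral_cmult) (simp add: \<psi>_def)
    also have "\<dots> \<le> ennreal (Z powr s) * ennreal J" by (intro mult_left_mono int) auto
    also have "\<dots> = ennreal ((J powr (1 / s) * Z) powr (1 / (1 / s)))"
      using J Z s by (simp add: powr_mult powr_powr ennreal_mult[symmetric] mult.commute)
    finally show "lorentz_norm q s f \<le> ennreal (J powr (1 / s) * Z)"
      unfolding lorentz_norm_def using s Z by (subst epowr_le_iff) auto
  qed auto
qed

section \<open>Independence of the representative\<close>

lemma AE_translate:
  fixes P :: "'a::euclidean_space \<Rightarrow> bool"
  assumes "AE x in lborel. P x"
  shows "AE x in lborel. P (x + c)"
proof -
  have "AE x in distr lborel borel ((+) c). P x" using assms by (subst lborel_distr_plus)
  from AE_distrD[OF _ this] show ?thesis by (simp add: add.commute)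
qed

text \<open>A difference involves finitely many translates, and translates of null sets are null.
  This lets a Lebesgue measurable function be replaced by a Borel one.\<close>

lemma besov_seminorm_cong_AE:
  assumes "AE x in lborel. f x = g x"
  shows "besov_seminorm k r p \<theta> j f = besov_seminorm k r p \<theta> j g"
proof -
  have "Lp_norm p (difference k j h f) = Lp_norm p (difference k j h g)" for h
  proof -
    have "AE x in lborel. \<forall>i\<in>{..k}. f (x + (real i * h) *\<^sub>R axis j 1) = g (x + (real i * h) *\<^sub>R axis j 1)"
      by (rule AE_finite_allI) (auto intro: AE_translate assms)
    then have "AE x in lborel. difference k j h f x = difference k j h g x"
      by (rule eventually_mono) (auto simp: difference_def intro!: sum.cong)
    then have "(\<integral>\<^sup>+ x. ennreal (\<bar>difference k j h f x\<bar> powr p) \<partial>lborel) =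
        (\<integral>\<^sup>+ x. ennreal (\<bar>difference k j h g x\<bar> powr p) \<partial>lborel)"
      by (intro nn_integral_cong_AE) (auto elim!: eventually_mono)
    then show ?thesis by (simp add: Lp_norm_lborel)
  qed
  then show ?thesis by (simp add: besov_seminorm_def)
qed

section \<open>From the distribution estimates to the Lorentz norm\<close>

theorem theorem1:
  fixes rv pv \<beta> :: "'n::finite \<Rightarrow> real" and \<theta> :: "'n \<Rightarrow> ennreal" and k :: "'n \<Rightarrow> nat"
    and n r p p0 q s :: real
  assumes n_eq: "n = real CARD('n)"
    and rv_pos: "\<And>j. 0 < rv j"
    and pv_ge: "\<And>j. 1 \<le> pv j"
    and \<theta>_ge: "\<And>j. 1 \<le> \<theta> j"
    and k_gt: "\<And>j. rv j < real (k j)"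
    and r_eq: "r = n * inverse (\<Sum>j\<in>UNIV. 1 / rv j)"
    and p_eq: "p = (n / r) * inverse (\<Sum>j\<in>UNIV. 1 / (pv j * rv j))"
    and \<beta>_eq: "\<And>j. \<beta> j = (1 / rv j) * (r / n + 1 / pv j - 1 / p)"
    and \<beta>_pos: "\<And>j. 0 < \<beta> j"
    and p0_pos: "0 < p0"
    and p0_cond: "1 / p0 > 1 / p - r / n"
    and q_gt: "max 1 p0 < q"
    and q_cond: "1 / q > 1 / p - r / n"
    and s_pos: "0 < s"
  shows "\<exists>c::real. \<forall>f :: real ^ 'n \<Rightarrow> real.
           locally_integrable f \<longrightarrow> f \<in> S0 \<longrightarrow>
           f \<in> besov_space k rv pv \<theta> \<longrightarrow> f \<in> L1_plus_Lp p0 \<longrightarrow>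
             f \<in> lorentz_space q s \<and>
             lorentz_norm q s f \<le> ennreal c *
               (L1_plus_Lp_norm p0 f +
                (\<Prod>j\<in>UNIV. besov_seminorm (k j) (rv j) (pv j) (\<theta> j) j f powr\<^sub>e (r / (n * rv j))))"
proof -
  define e where "e j = r / (n * rv j)" for j
  define M :: real where "M = (\<Prod>j\<in>UNIV. 2 ^ k j)"
  define b2 where "b2 = min 1 (1 / p0)"
  define c1 where "c1 = 8 + 2 * 4 powr (1 / p0)"
  have n: "0 < n" by (simp add: n_eq)
  have "0 < (\<Sum>j\<in>UNIV. 1 / rv j)" using rv_pos by (intro sum_pos) auto
  then have r: "0 < r" using n by (simp add: r_eq)
  have e: "0 < e j" for j using r n rv_pos by (simp add: e_def)
  have q: "0 < q" "1 < q" "p0 < q" using q_gt by auto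
  \<comment> \<open>The bound \<open>max 1 p0 < q\<close> makes the decay rate \<open>b2\<close>
    large enough for integrability at infinity.\<close>
  have b2: "1 / q < b2" using q p0_pos by (simp add: b2_def field_simps)
  have c1: "0 \<le> c1" by (simp add: c1_def)
  \<comment> \<open>The exponent must exceed \<open>1 / p - r / n\<close> for the iteration and stay
    below \<open>1 / q\<close> for integrability at 0.\<close>
  obtain b where b: "1 / p - r / n < b" "0 < b" "b < 1 / q"
    using dense[of "max (1 / p - r / n) 0" "1 / q"] q_cond q by auto
  have M: "1 \<le> M" unfolding M_def by (intro prod_ge_1) auto
  \<comment> \<open>Gives \<open>\<xi> powr b = 2 * M\<close>. The choice is not circular, since
    \<open>M\<close> depends on the orders \<open>k j\<close> alone; the constant \<open>C\<close>
    is obtained afterwards.\<close>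
  define \<xi> where "\<xi> = (2 * M) powr (1 / b)"
  have \<xi>: "1 < \<xi>" "2 * M \<le> \<xi> powr b"
    using M b by (auto simp: \<xi>_def powr_powr intro: gr_one_powr)
  obtain C where C: "0 \<le> C" and step: "\<And>(g :: real ^ 'n \<Rightarrow> real) B \<mu> t.
      g \<in> borel_measurable borel \<Longrightarrow> \<forall>y>0. emeasure lborel {x. y < \<bar>g x\<bar>} < \<infinity> \<Longrightarrow>
      \<forall>j. 0 < B j \<and> besov_seminorm (k j) (rv j) (pv j) (\<theta> j) j g \<le> ennreal (B j) \<Longrightarrow>
      0 \<le> \<mu> \<Longrightarrow> 0 < t \<Longrightarrow> emeasure lborel {x. \<mu> < \<bar>g x\<bar>} \<le> ennreal (\<xi> * t) \<Longrightarrow>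
      emeasure lborel {x. M * \<mu> + C * (\<Prod>j\<in>UNIV. B j powr e j) * t powr (r / n - 1 / p) < \<bar>g x\<bar>} \<le> ennreal t"
    using distribution_step[where k = k and rv = rv and pv = pv and \<theta> = \<theta> and \<xi> = \<xi>, OF n_eq rv_pos pv_ge \<theta>_ge r_eq p_eq] \<xi>
    unfolding M_def e_def by auto
  obtain Cq where Cq: "0 \<le> Cq" and lorentz: "\<And>(f :: real ^ 'n \<Rightarrow> real) Z. 0 \<le> Z \<Longrightarrow>
      \<forall>t>0. rearrangement f t \<le> ennreal (Z * (if t \<le> 1 then t powr (- b) else t powr (- b2))) \<Longrightarrow>
      lorentz_norm q s f \<le> ennreal (Cq * Z)"
    using lorentz_norm_le[where ?'n = 'n, OF s_pos b(3) b2] by blast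
  define c where "c = Cq * (c1 + \<xi> powr b * (c1 + 2 * C))"
  have c: "0 \<le> c" using Cq c1 C by (simp add: c_def)
  \<comment> \<open>Positive majorants \<open>A\<close> and \<open>B j\<close> replace the norms,
    since the infimum need not be attained and seminorms may vanish.\<close>
  have main: "lorentz_norm q s f \<le> ennreal (c * (A + (\<Prod>j\<in>UNIV. B j powr e j)))"
    if f: "f \<in> S0" and gh: "g \<in> Lp_space 1" "h \<in> Lp_space p0" "AE x in lebesgue. f x = g x + h x"
      "Lp_norm 1 g + Lp_norm p0 h \<le> ennreal A" and A: "0 < A"
      and B: "\<And>j. 0 < B j" "\<And>j. besov_seminorm (k j) (rv j) (pv j) (\<theta> j) j f \<le> ennreal (B j)"
    for f g h :: "real ^ 'n \<Rightarrow> real" and A B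
  proof -
    define D where "D = (\<Prod>j\<in>UNIV. B j powr e j)"
    have D: "0 \<le> D" unfolding D_def by (intro prod_nonneg) auto
    define Z where "Z = (c1 + \<xi> powr b * (c1 + 2 * C)) * (A + D)"
    define d where "d \<mu> = emeasure lebesgue {x. \<mu> < \<bar>f x\<bar>}" for \<mu>
    have f_meas [measurable]: "f \<in> borel_measurable lebesgue" using f by (simp add: S0_def)
    have level: "{x. \<mu> < \<bar>f x\<bar>} \<in> sets lebesgue" for \<mu>
      by (rule sets_lebesgue_abs_greater[OF f_meas])
    \<comment> \<open>Fubini's theorem in \<open>distribution_recursion\<close> is applied to a
      Borel function; the representative has the same distribution function and seminorms.\<close>
    obtain f' where f' [measurable]: "f' \<in> borel_measurable borel" and ff': "AE x in lborel. f x = f' x"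
      using completion_ex_borel_measurable_real[OF f_meas] by auto
    have d_eq: "emeasure lborel {x. \<mu> < \<bar>f' x\<bar>} = d \<mu>" for \<mu>
    proof -
      have "{x. \<mu> < \<bar>f' x\<bar>} \<in> sets borel" by measurable
      then have "emeasure lborel {x. \<mu> < \<bar>f' x\<bar>} = emeasure lebesgue {x. \<mu> < \<bar>f' x\<bar>}"
        by (simp add: emeasure_completion)
      also have "\<dots> = d \<mu>" unfolding d_def
      proof (rule emeasure_eq_AE)
        show "AE x in lebesgue. x \<in> {x. \<mu> < \<bar>f' x\<bar>} \<longleftrightarrow> x \<in> {x. \<mu> < \<bar>f x\<bar>}"
          using AE_completion[OF ff'] by (rule eventually_mono) auto
        show "{x. \<mu> < \<bar>f' x\<bar>} \<in> sets lebesgue"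
          using \<open>{x. \<mu> < \<bar>f' x\<bar>} \<in> sets borel\<close> by auto
      qed (rule level)
      finally show ?thesis .
    qed
    have fin: "\<forall>y>0. emeasure lborel {x. y < \<bar>f' x\<bar>} < \<infinity>"
      using f unfolding d_eq d_def by (auto simp: S0_def)
    have B': "\<forall>j. 0 < B j \<and> besov_seminorm (k j) (rv j) (pv j) (\<theta> j) j f' \<le> ennreal (B j)"
      using B besov_seminorm_cong_AE[OF ff'] by auto
    have anti: "d \<mu>' \<le> d \<mu>" if "\<mu> \<le> \<mu>'" for \<mu> \<mu>'
      unfolding d_def by (rule emeasure_mono) (use that level in auto)
    have large: "d (c1 * A * t powr (- b2)) \<le> ennreal (t / 2)" if "1 \<le> t" for t
      unfolding d_def c1_def b2_def
      by (rule distribution_L1_plus_Lp_le[of f g h]) (use gh A p0_pos that in \<open>auto simp: Lp_space_def\<close>)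
    \<comment> \<open>The iteration starts at the level \<open>c1 * A\<close>, above which the
      measure is at most 1/2 by \<open>large\<close> at \<open>t = 1\<close>.\<close>
    have small: "d ((\<xi> / t) powr b * (c1 * A + 2 * (C * D))) < ennreal t" if t: "0 < t" "t \<le> 1" for t
    proof (rule distribution_iterate[of d \<xi> M "C * D" "1 / p - r / n" "c1 * A" b t])
      show "d (M * \<mu> + C * D * t powr (- (1 / p - r / n))) \<le> ennreal t"
        if "0 \<le> \<mu>" "0 < t" "d \<mu> \<le> ennreal (\<xi> * t)" for \<mu> t
        using step[OF f' fin B' that(1,2)] that(3) by (simp add: d_eq D_def)
      have "d (c1 * A) \<le> ennreal (1 / 2)" using large[of 1] by simp
      also have "\<dots> \<le> 1" by (subst ennreal_1[symmetric], rule ennreal_leI) simp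
      finally show "d (c1 * A) \<le> 1" .
    qed (use anti c1 A C D \<xi> b t in auto)
    have "\<forall>t>0. rearrangement f t \<le> ennreal (Z * (if t \<le> 1 then t powr (- b) else t powr (- b2)))"
    proof (intro allI impI)
      fix t :: real assume t: "0 < t"
      have Z1: "c1 * A \<le> Z"
      proof -
        have "c1 * A \<le> (c1 + \<xi> powr b * (c1 + 2 * C)) * (A + D)"
          using c1 C A D by (intro mult_mono) auto
        then show ?thesis by (simp add: Z_def)
      qed
      have Z2: "\<xi> powr b * (c1 * A + 2 * (C * D)) \<le> Z"
      proof -
        have "c1 * A + 2 * (C * D) \<le> (c1 + 2 * C) * (A + D)"
          using c1 C A D by (simp add: algebra_simps)
        then have "\<xi> powr b * (c1 * A + 2 * (C * D)) \<le> \<xi> powr b * ((c1 + 2 * C) * (A + D))"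
          by (intro mult_left_mono) auto
        also have "\<dots> \<le> (c1 + \<xi> powr b * (c1 + 2 * C)) * (A + D)"
          using c1 C A D by (simp add: distrib_right mult.assoc)
        finally show ?thesis by (simp add: Z_def)
      qed
      show "rearrangement f t \<le> ennreal (Z * (if t \<le> 1 then t powr (- b) else t powr (- b2)))"
      proof (cases "t \<le> 1")
        case True
        have "rearrangement f t \<le> ennreal ((\<xi> / t) powr b * (c1 * A + 2 * (C * D)))"
          by (rule rearrangement_le[OF small[OF t True, unfolded d_def] level])
        also have "(\<xi> / t) powr b * (c1 * A + 2 * (C * D)) = \<xi> powr b * (c1 * A + 2 * (C * D)) * t powr (- b)"
          using t \<xi> by (simp add: powr_divide powr_minus_divide)
        also have "ennreal \<dots> \<le> ennreal (Z * t powr (- b))"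
          using Z2 by (intro ennreal_leI mult_right_mono) auto
        finally show ?thesis using True by simp
      next
        case False
        have "d (c1 * A * t powr (- b2)) \<le> ennreal (t / 2)" using False by (intro large) auto
        also have "\<dots> < ennreal t" using t by (intro ennreal_lessI) auto
        finally have "rearrangement f t \<le> ennreal (c1 * A * t powr (- b2))"
          unfolding d_def by (rule rearrangement_le[OF _ level])
        also have "\<dots> \<le> ennreal (Z * t powr (- b2))"
          using Z1 by (intro ennreal_leI mult_right_mono) auto
        finally show ?thesis using False by simp
      qed
    qed
    moreover have "0 \<le> Z"
      unfolding Z_def using c1 C A D by (intro mult_nonneg_nonneg add_nonneg_nonneg) auto
    ultimately have "lorentz_norm q s f \<le> ennreal (Cq * Z)" by (rule lorentz[rotated])
    then show ?thesis by (simp add: Z_def c_def D_def mult.assoc)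
  qed
  show ?thesis
  proof (intro exI[of _ c] allI impI)
    fix f :: "real ^ 'n \<Rightarrow> real"
    assume S0: "f \<in> S0" and besov: "f \<in> besov_space k rv pv \<theta>" and L1: "f \<in> L1_plus_Lp p0"
    define bs where "bs j = besov_seminorm (k j) (rv j) (pv j) (\<theta> j) j f" for j
    define B where "B j = enn2real (bs j)" for j
    have "(\<Sum>j\<in>UNIV. bs j) < \<infinity>" using besov by (simp add: besov_space_def bs_def)
    then have "bs j < \<infinity>" for j by simp
    then have B: "bs j = ennreal (B j)" "0 \<le> B j" for j
      by (simp_all add: B_def)
    obtain g h where "g \<in> Lp_space 1" "h \<in> Lp_space p0" "AE x in lebesgue. f x = g x + h x"
      using L1 by (auto simp: L1_plus_Lp_def)
    then have "L1_plus_Lp_norm p0 f \<le> Lp_norm 1 g + Lp_norm p0 h" "Lp_norm 1 g + Lp_norm p0 h < \<infinity>"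
      unfolding L1_plus_Lp_norm_def by (auto intro!: Inf_lower simp: Lp_space_def)
    then have "L1_plus_Lp_norm p0 f < \<infinity>" by (rule le_less_trans)
    then obtain A where A: "L1_plus_Lp_norm p0 f = ennreal A" "0 \<le> A"
      by (cases "L1_plus_Lp_norm p0 f") auto
    \<comment> \<open>The margin yields positive majorants and a decomposition whose norms sum to
      less than \<open>A + \<epsilon>\<close>.\<close>
    have bound: "lorentz_norm q s f \<le> ennreal (c * ((A + \<epsilon>) + (\<Prod>j\<in>UNIV. (B j + \<epsilon>) powr e j)))"
      if \<epsilon>: "0 < \<epsilon>" for \<epsilon>
    proof -
      have "L1_plus_Lp_norm p0 f < ennreal (A + \<epsilon>)"
        unfolding A(1) using A(2) \<epsilon> by (intro ennreal_lessI) auto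
      then obtain g h where gh: "g \<in> Lp_space 1" "h \<in> Lp_space p0" "AE x in lebesgue. f x = g x + h x"
          "Lp_norm 1 g + Lp_norm p0 h < ennreal (A + \<epsilon>)"
        unfolding L1_plus_Lp_norm_def Inf_less_iff by auto
      show ?thesis
      proof (rule main[OF S0 gh(1,2,3)])
        show "0 < B j + \<epsilon>" for j using B(2)[of j] \<epsilon> by simp
        show "besov_seminorm (k j) (rv j) (pv j) (\<theta> j) j f \<le> ennreal (B j + \<epsilon>)" for j
          unfolding bs_def[symmetric] B(1) using \<epsilon> by (intro ennreal_leI) auto
      qed (use gh A \<epsilon> in auto)
    qed
    \<comment> \<open>The margin is removed by a limit: the exponents \<open>e j\<close> are
      positive, so the powers are continuous from the right even where
      \<open>B j = 0\<close>.\<close>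
    have "((\<lambda>\<epsilon>. ennreal (c * ((A + \<epsilon>) + (\<Prod>j\<in>UNIV. (B j + \<epsilon>) powr e j)))) \<longlongrightarrow>
        ennreal (c * ((A + 0) + (\<Prod>j\<in>UNIV. (B j + 0) powr e j)))) (at_right 0)"
    proof (intro tendsto_intros disjI2 conjI)
      show "\<forall>\<^sub>F \<epsilon> in at_right 0. 0 \<le> B j + \<epsilon>" for j
        using eventually_at_right_less[of "0::real"] by (rule eventually_mono) (use B(2)[of j] in auto)
    qed (rule e)
    then have "lorentz_norm q s f \<le> ennreal (c * ((A + 0) + (\<Prod>j\<in>UNIV. (B j + 0) powr e j)))"
      by (rule tendsto_lowerbound)
         (auto intro!: eventually_mono[OF eventually_at_right_less[of "0::real"]] bound)
    also have "\<dots> = ennreal c * (ennreal A + ennreal (\<Prod>j\<in>UNIV. B j powr e j))"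
      using c A by (simp add: ennreal_mult prod_nonneg)
    also have "ennreal (\<Prod>j\<in>UNIV. B j powr e j) = (\<Prod>j\<in>UNIV. bs j powr\<^sub>e e j)"
      by (simp add: B epowr_def prod_ennreal)
    finally have le: "lorentz_norm q s f \<le> ennreal c * (L1_plus_Lp_norm p0 f + (\<Prod>j\<in>UNIV. bs j powr\<^sub>e e j))"
      by (simp add: A)
    have "lorentz_norm q s f < \<infinity>" using bound[of 1] by (simp add: le_less_trans)
    then show "f \<in> lorentz_space q s \<and>
             lorentz_norm q s f \<le> ennreal c *
               (L1_plus_Lp_norm p0 f +
                (\<Prod>j\<in>UNIV. besov_seminorm (k j) (rv j) (pv j) (\<theta> j) j f powr\<^sub>e (r / (n * rv j))))"
      using le S0 by (simp add: lorentz_space_def bs_def e_def)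
  qed
qed

end
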